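(* Let $g:\mathbb{R}^m\to\mathbb{R}^l$ be twice continuously differentiable, let $\Theta\subset\mathbb{R}^l$ be a closed convex cone, let $\Gamma:=g^{-1}(\Theta)$, let $f:\mathbb{R}^n\times\mathbb{R}^m\to\mathbb{R}^m$, and let $$S(x):=\{y\in\mathbb{R}^m\mid 0\in f(x,y)+\widehat N_\Gamma(y)\},\quad x\in\mathbb{R}^n.$$ Let $(\bar x,\bar y)\in\operatorname{gph}S$, suppose that $f$ is smooth (continuously differentiable) around $(\bar x,\bar y)$, that the standing assumptions (A1), (A2), (A3) given in the context hold at $\bar y$, and that $\Theta$ satisfies the projection derivation condition (PDC) at $g(\bar y)$. Let $\mathcal{L}(x,y,\lambda):=f(x,y)+(\nabla g(y))^T\lambda$ for $\lambda\in\mathbb{R}^l$, and let $\bar\lambda\in N_\Theta(g(\bar y))$ be the unique Lagrange multiplier satisfying $\mathcal{L}(\bar x,\bar y,\bar\lambda)=0$. Then for any $u\in\mathbb{R}^n$ we have the inclusion $$DS(\bar x,\bar y)(u)\subset\big\{v\in\mathbb{R}^m\,\big|\;0\in\nabla_xf(\bar x,\bar y)u+\nabla_y\mathcal{L}(\bar x,\bar y,\bar\lambda)v+(\nabla g(\bar y))^TN_{\widehat{\mathcal K}}\big(\nabla g(\bar y)v\big)\big\},$$ where $\widehat{\mathcal K}:=\mathcal{K}(g(\bar y),\bar\lambda)=T_\Theta(g(\bar y))\cap\{\bar\lambda\}^\perp$. Furthermore, this inclusion becomes an equality provided that the partial Jacobian $\nabla_xf(\bar x,\bar y)$ is surjec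tive.
   Context: Notation: $\nabla g(y)$ is the Jacobian of $g$ at $y$; $\nabla_x,\nabla_y$ are partial Jacobians; $P_\Omega$ is the Euclidean metric projection onto a closed set $\Omega$; $f'(x;h)$ is the classical directional derivative. For convex sets $C$, $N_C(z)$ is the normal cone of convex analysis, with $N_C(z)=\emptyset$ for $z\notin C$. Tangent cone: $T_\Omega(\bar z):=\{z\mid\exists\,t_k\downarrow0,\ z_k\to z\text{ with }\bar z+t_kz_k\in\Omega\}$. Regular normal cone: $\widehat N_\Omega(y):=\{v\mid\limsup_{u\to y,\,u\in\Omega}\langle v,u-y\rangle/\|u-y\|\le0\}$ for $y\in\Omega$, and $\widehat N_\Omega(y)=\emptyset$ for $y\notin\Omega$. Graphical derivative of $F:\mathbb{R}^n\rightrightarrows\mathbb{R}^m$ at $(\bar x,\bar y)\in\operatorname{gph}F$: $DF(\bar x,\bar y)(u):=\{v\mid(u,v)\in T_{\operatorname{gph}F}(\bar x,\bar y)\}$. Critical cone: $\mathcal{K}(\bar z,b):=T_\Theta(\bar z)\cap\{b\}^\perp$. Projection derivation condition (PDC) of $\Theta$ at $\bar z\in\Theta$: $P'_\Theta(\bar z+b;h)=P_{\mathcal{K}(\bar z,b)}(h)$ for all $b\in N_\Theta(\bar z)$ and all $h\in\mathbb{R}^l$. Standing assumptions, with $\bar z:=g(\bar y)$: (A1) $\Theta$ is $\mathcal{C}^2$-reducible at $\bar z$ to a closed convex set $\Xi\subset\mathbb{R}^q$, and the reduction is pointed: there exist a neighborhood $V$ of $\bar z$ and a $\mathcal{C}^2$-smooth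 mapping $\eta:V\to\mathbb{R}^q$ such that for all $z\in V$ one has $z\in\Theta$ if and only if $\eta(z)\in\Xi$, the cone $T_\Xi(\eta(\bar z))$ is pointed, $\eta(\bar z)=0$, and $\nabla\eta(\bar z):\mathbb{R}^l\to\mathbb{R}^q$ is surjective. (A2) $\bar y$ is nondegenerate for $g$ with respect to $\Theta$: $\nabla g(\bar y)\mathbb{R}^m+\operatorname{lin}(T_\Theta(\bar z))=\mathbb{R}^l$, where $\operatorname{lin}(Q)$ denotes the largest linear subspace contained in $Q$. (A3) The metric projection $P_\Theta$ is directionally differentiable on $\mathbb{R}^l$. *)

theory Defs
  imports "HOL-Analysis.Analysis"
begin

section \<open>Smoothness and directional derivatives\<close>

definition C1_on :: "'a::real_normed_vector set \<Rightarrow> ('a \<Rightarrow> 'b::real_normed_vector) \<Rightarrow> bool" where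
  "C1_on S f \<longleftrightarrow>
     open S \<and>
     (\<exists>f' :: 'a \<Rightarrow> 'a \<Rightarrow>\<^sub>L 'b.
        (\<forall>x\<in>S. (f has_derivative blinfun_apply (f' x)) (at x)) \<and> continuous_on S f')"

definition C2_on :: "'a::real_normed_vector set \<Rightarrow> ('a \<Rightarrow> 'b::real_normed_vector) \<Rightarrow> bool" where
  "C2_on S f \<longleftrightarrow>
     open S \<and>
     (\<exists>f' :: 'a \<Rightarrow> 'a \<Rightarrow>\<^sub>L 'b.
        (\<forall>x\<in>S. (f has_derivative blinfun_apply (f' x)) (at x)) \<and> C1_on S f')"

definition has_dir_derivative ::
  "('a::real_normed_vector \<Rightarrow> 'b::real_normed_vector) \<Rightarrow> 'a \<Rightarrow> 'a \<Rightarrow> 'b \<Rightarrow> bool" where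
  "has_dir_derivative f x h d \<longleftrightarrow>
     ((\<lambda>t. (f (x + t *\<^sub>R h) - f x) /\<^sub>R t) \<longlongrightarrow> d) (at_right 0)"

section \<open>Tangent and normal cones, graphical derivatives\<close>

definition tangent_cone :: "'a::real_normed_vector set \<Rightarrow> 'a \<Rightarrow> 'a set" where
  "tangent_cone \<Omega> zb =
     {z. \<exists>(t :: nat \<Rightarrow> real) (w :: nat \<Rightarrow> 'a).
           (\<forall>k. t k > 0) \<and> t \<longlonglongrightarrow> 0 \<and> w \<longlonglongrightarrow> z \<and> (\<forall>k. zb + t k *\<^sub>R w k \<in> \<Omega>)}"

text \<open>
  The limes superior is taken over \<open>u \<noteq> y\<close>. At an isolated point of \<open>\<Omega>\<close> the filter is trivial and
  the limes superior is \<open>-\<infinity>\<close>, so every vector is a regular normal.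
\<close>

definition regular_normal_cone :: "'a::real_inner set \<Rightarrow> 'a \<Rightarrow> 'a set" where
  "regular_normal_cone \<Omega> y =
     (if y \<in> \<Omega>
      then {v. Limsup (at y within \<Omega>) (\<lambda>u. ereal (inner v (u - y) / norm (u - y))) \<le> 0}
      else {})"

definition normal_cone :: "'a::real_inner set \<Rightarrow> 'a \<Rightarrow> 'a set" where
  "normal_cone C z = (if z \<in> C then {v. \<forall>u\<in>C. inner v (u - z) \<le> 0} else {})"

definition gph :: "('a \<Rightarrow> 'b set) \<Rightarrow> ('a \<times> 'b) set" where
  "gph F = {(x, y). y \<in> F x}"

definition graphical_derivative ::
  "('a::real_normed_vector \<Rightarrow> 'b::real_normed_vector set) \<Rightarrow> 'a \<times> 'b \<Rightarrow> 'a \<Rightarrow> 'b set" where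
  "graphical_derivative F p u = {v. (u, v) \<in> tangent_cone (gph F) p}"

definition critical_cone :: "'a::real_inner set \<Rightarrow> 'a \<Rightarrow> 'a \<Rightarrow> 'a set" where
  "critical_cone \<Theta> z b = tangent_cone \<Theta> z \<inter> {w. inner b w = 0}"

definition lin :: "'a::real_vector set \<Rightarrow> 'a set" where
  "lin Q = (GREATEST L. subspace L \<and> L \<subseteq> Q)"

definition pointed :: "'a::real_vector set \<Rightarrow> bool" where
  "pointed K \<longleftrightarrow> K \<inter> uminus ` K = {0}"

section \<open>Conditions on the constraint system\<close>

definition PDC :: "'a::euclidean_space set \<Rightarrow> 'a \<Rightarrow> bool" where
  "PDC \<Theta> z \<longleftrightarrow>
     (\<forall>b\<in>normal_cone \<Theta> z. \<forall>h.
        has_dir_derivative (closest_point \<Theta>) (z + b) h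
          (closest_point (critical_cone \<Theta> z b) h))"

text \<open>
  The space in which the reducing set \<open>\<Xi>\<close> lives is a linear subspace \<open>E\<close> of a coordinate space:
  \<open>E = UNIV\<close> is the case of the full coordinate space, and \<open>E = {0}\<close> is the zero-dimensional
  case, which no type \<open>real^'q\<close> represents. That case is the one where \<open>z\<close> is an
  interior point of \<open>\<Theta>\<close>.
\<close>

definition C2_reducible_pointed ::
  "(real^'l) set \<Rightarrow> real^'l \<Rightarrow> (real^'q) set \<Rightarrow> (real^'q) set \<Rightarrow> bool" where
  "C2_reducible_pointed \<Theta> z E \<Xi> \<longleftrightarrow>
     subspace E \<and> \<Xi> \<subseteq> E \<and> closed \<Xi> \<and> convex \<Xi> \<and>
     (\<exists>(V :: (real^'l) set) (\<eta> :: real^'l \<Rightarrow> real^'q).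
        z \<in> V \<and> C2_on V \<eta> \<and> \<eta> ` V \<subseteq> E \<and>
        (\<forall>w\<in>V. w \<in> \<Theta> \<longleftrightarrow> \<eta> w \<in> \<Xi>) \<and>
        pointed (tangent_cone \<Xi> (\<eta> z)) \<and>
        \<eta> z = 0 \<and>
        range (\<lambda>h. jacobian \<eta> (at z) *v h) = E)"

definition nondegenerate ::
  "(real^'m \<Rightarrow> real^'l) \<Rightarrow> (real^'l) set \<Rightarrow> real^'m \<Rightarrow> bool" where
  "nondegenerate g \<Theta> y \<longleftrightarrow>
     {jacobian g (at y) *v a + b | a b. b \<in> lin (tangent_cone \<Theta> (g y))} = UNIV"

section \<open>The parametric variational system\<close>

definition solution_map ::
  "('a \<times> 'b \<Rightarrow> 'b::real_inner) \<Rightarrow> 'b set \<Rightarrow> 'a \<Rightarrow> 'b set" where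
  "solution_map f \<Gamma> x = {y. 0 \<in> (\<lambda>w. f (x, y) + w) ` regular_normal_cone \<Gamma> y}"

definition lagrangian ::
  "('a \<times> (real^'m) \<Rightarrow> real^'m) \<Rightarrow> (real^'m \<Rightarrow> real^'l) \<Rightarrow> 'a \<Rightarrow> real^'m \<Rightarrow> real^'l \<Rightarrow> real^'m" where
  "lagrangian f g x y lam = f (x, y) + transpose (jacobian g (at y)) *v lam"

end

theory Submission
  imports Defs
begin

text \<open>
  Write \<open>zb = g yb\<close>, \<open>F = \<eta> \<circ> g\<close> and \<open>K\<close> for the critical cone, and let \<open>P\<^sub>C\<close> be the projection
  onto a closed convex set \<open>C\<close>. Nondegeneracy and pointedness of the reduction make \<open>\<nabla>F(yb)\<close>
  onto the space \<open>E\<close> that carries \<open>\<Xi>\<close> (\<open>nondegenerate_range_reduction\<close>). Hence, uniformly near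
  \<open>yb\<close>, the regular normals of \<open>\<Gamma> = F\<^sup>-\<^sup>1(\<Xi>)\<close> are the vectors \<open>\<nabla>F(y)\<^sup>T \<mu>\<close> with
  \<open>\<mu> \<in> N\<^sub>\<Xi>(F y) \<inter> E\<close>, and \<open>\<mu>\<close> is bounded by a multiple of its image; the same holds for \<open>\<Theta>\<close>
  and \<open>\<eta>\<close> (\<open>regular_normals_of_preimage\<close>). So graph points of \<open>S\<close> near the reference point are
  the solutions of \<open>f(x, y) + \<nabla>g(y)\<^sup>T \<lambda> = 0\<close> with \<open>\<lambda> \<in> N\<^sub>\<Theta>(g y)\<close>, and the latter means
  \<open>P\<^sub>\<Theta>(g y + \<lambda>) = g y\<close>.
  
  For the inclusion, take graph points \<open>(x\<^sub>k, y\<^sub>k)\<close> that approach the reference point in direction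
  \<open>(u, v)\<close>. By the multiplier bound the difference quotients of the reduced multipliers are
  bounded, so along a subsequence \<open>\<lambda>\<^sub>k = lamb + t\<^sub>k w + o(t\<^sub>k)\<close>. Differentiating
  \<open>P\<^sub>\<Theta>(g y\<^sub>k + \<lambda>\<^sub>k) = g y\<^sub>k\<close> by the projection derivation condition gives
  \<open>P\<^sub>K(\<nabla>g(yb) v + w) = \<nabla>g(yb) v\<close>, that is, \<open>w \<in> N\<^sub>K(\<nabla>g(yb) v)\<close>, and differentiating the
  generalized equation gives the asserted identity (\<open>tangent_graph_imp_equation\<close>).
  
  Conversely, given \<open>w\<close>, the projections \<open>Z\<^sub>k\<close> of \<open>zb + lamb + t\<^sub>k (\<nabla>g(yb) v + w)\<close> onto \<open>\<Theta>\<close> satisfy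
  \<open>Z\<^sub>k = zb + t\<^sub>k \<nabla>g(yb) v + o(t\<^sub>k)\<close>, and the remainders are normals \<open>lamb + t\<^sub>k w + o(t\<^sub>k)\<close>.
  Solving \<open>F(y) = \<eta>(Z\<^sub>k)\<close> and transporting the multipliers through \<open>\<eta>\<close> produces feasible
  \<open>y\<^sub>k = yb + t\<^sub>k v + o(t\<^sub>k)\<close> with normals of the same expansion. The generalized equation then
  holds up to \<open>o(t\<^sub>k)\<close>, and since \<open>\<nabla>\<^sub>xf\<close> is onto, a correction of \<open>xb + t\<^sub>k u\<close> by \<open>o(t\<^sub>k)\<close> makes it
  exact (\<open>equation_imp_tangent_graph\<close>). All corrections come from one contraction argument
  (\<open>solve_by_contraction\<close>, used through \<open>metric_regularity\<close> and \<open>correct_tangential\<close>).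
\<close>

section \<open>Adjoints\<close>

text \<open>
  The adjoint \<open>adj T\<close> of a bounded linear map \<open>T\<close>; for \<open>T = \<nabla>g(y)\<close> it is multiplication
  by the transposed Jacobian. It is bilinear in \<open>T\<close> and its argument, so that product rules apply
  to \<open>adj (g' y) \<lambda>\<close>.
\<close>
abbreviation adj :: "('a::euclidean_space \<Rightarrow>\<^sub>L 'b::euclidean_space) \<Rightarrow> 'b \<Rightarrow> 'a" where
  "adj T \<equiv> adjoint (blinfun_apply T)"

lemma inner_adj: "x \<bullet> adj T y = T x \<bullet> y"
  by (rule adjoint_works) (rule bounded_linear.linear[OF blinfun.bounded_linear_right])

lemma norm_adj_le: "norm (adj T y) \<le> norm T * norm y"
proof -
  have "norm (adj T y) * norm (adj T y) = T (adj T y) \<bullet> y"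
    by (metis inner_adj power2_eq_square power2_norm_eq_inner)
  also have "\<dots> \<le> norm (T (adj T y)) * norm y"
    by (rule norm_cauchy_schwarz)
  also have "\<dots> \<le> (norm T * norm (adj T y)) * norm y"
    by (intro mult_right_mono norm_blinfun) auto
  finally have "norm (adj T y) * norm (adj T y) \<le> norm (adj T y) * (norm T * norm y)"
    by (simp add: algebra_simps)
  then show ?thesis
    by (cases "norm (adj T y) = 0") (auto simp: mult_le_cancel_left)
qed

lemma bounded_bilinear_adj:
  "bounded_bilinear (adj :: ('a::euclidean_space \<Rightarrow>\<^sub>L 'b::euclidean_space) \<Rightarrow> 'b \<Rightarrow> 'a)"
proof
  show "\<exists>K. \<forall>T y. norm (adj T y :: 'a) \<le> norm T * norm (y :: 'b) * K"
    by (rule exI[of _ 1]) (simp add: norm_adj_le)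
qed (rule iffD1[OF vector_eq_ldot],
     simp add: inner_adj inner_add_right inner_add_left blinfun.add_left blinfun.scaleR_left)+

interpretation adj: bounded_bilinear
  "adj :: ('a::euclidean_space \<Rightarrow>\<^sub>L 'b::euclidean_space) \<Rightarrow> 'b \<Rightarrow> 'a"
  by (rule bounded_bilinear_adj)

lemma adj_compose: "adj (S o\<^sub>L T) y = adj T (adj S y)"
  by (rule iffD1[OF vector_eq_ldot]) (simp add: inner_adj)

section \<open>First-order expansions along sequences\<close>

text \<open>
  Step sizes \<open>t\<^sub>k\<close> that are positive and tend to \<open>0\<close>.
\<close>
definition steps :: "(nat \<Rightarrow> real) \<Rightarrow> bool" where
  "steps t \<longleftrightarrow> (\<forall>k. t k > 0) \<and> t \<longlonglongrightarrow> 0"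

text \<open>
  The sequence \<open>X\<close> has the first-order expansion \<open>X\<^sub>k = x + t\<^sub>k h + o(t\<^sub>k)\<close>. With this notion the
  tangent cone to \<open>\<Omega>\<close> at \<open>x\<close> consists of the directions \<open>h\<close> of sequences in \<open>\<Omega>\<close>, and the
  chain, product and projection rules are statements about sequences.
\<close>
definition tangential :: "(nat \<Rightarrow> real) \<Rightarrow> (nat \<Rightarrow> 'a::real_normed_vector) \<Rightarrow> 'a \<Rightarrow> 'a \<Rightarrow> bool" where
  "tangential t X x h \<longleftrightarrow> (\<lambda>k. (X k - x) /\<^sub>R t k) \<longlonglongrightarrow> h"

lemma steps_pos: "steps t \<Longrightarrow> t k > 0" and steps_nonzero: "steps t \<Longrightarrow> t k \<noteq> 0"
  by (auto simp: steps_def dest: spec[of _ k])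

lemma steps_harmonic: "steps (\<lambda>k. 1 / real (Suc k))"
  unfolding steps_def using LIMSEQ_inverse_real_of_nat by (auto simp: inverse_eq_divide)

lemma steps_subseq: "steps t \<Longrightarrow> strict_mono r \<Longrightarrow> steps (t \<circ> r)"
  unfolding steps_def by (auto intro: LIMSEQ_subseq_LIMSEQ)

lemma tangential_subseq:
  "tangential t X x h \<Longrightarrow> strict_mono r \<Longrightarrow> tangential (t \<circ> r) (X \<circ> r) x h"
  unfolding tangential_def by (drule (1) LIMSEQ_subseq_LIMSEQ) (simp add: o_def)

lemma tangential_ray: "steps t \<Longrightarrow> tangential t (\<lambda>k. x + t k *\<^sub>R h) x h"
  unfolding tangential_def by (simp add: steps_nonzero)

lemma tangential_const: "tangential t (\<lambda>k. x) x 0"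
  unfolding tangential_def by simp

lemma tangential_add:
  "tangential t X x h \<Longrightarrow> tangential t Y y k \<Longrightarrow> tangential t (\<lambda>n. X n + Y n) (x + y) (h + k)"
  unfolding tangential_def by (drule (1) tendsto_add) (simp add: algebra_simps)

lemma tangential_minus:
  "tangential t X x h \<Longrightarrow> tangential t (\<lambda>n. - X n) (- x) (- h)"
  unfolding tangential_def by (drule tendsto_minus) (simp add: algebra_simps)

lemma tangential_diff:
  "tangential t X x h \<Longrightarrow> tangential t Y y k \<Longrightarrow> tangential t (\<lambda>n. X n - Y n) (x - y) (h - k)"
  using tangential_add[OF _ tangential_minus, of t X x h Y y k] by simp

lemma tangential_Pair:
  "tangential t X x h \<Longrightarrow> tangential t Y y k \<Longrightarrow> tangential t (\<lambda>n. (X n, Y n)) (x, y) (h, k)"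
  unfolding tangential_def by (drule (1) tendsto_Pair) simp

lemma tangential_unique:
  "tangential t X x h \<Longrightarrow> tangential t X x h' \<Longrightarrow> h = h'"
  unfolding tangential_def by (rule LIMSEQ_unique)

lemma tangential_perturb:
  assumes "tangential t X x h" "(\<lambda>k. (Y k - X k) /\<^sub>R t k) \<longlonglongrightarrow> 0"
  shows "tangential t Y x h"
proof -
  have "(\<lambda>k. (X k - x) /\<^sub>R t k + (Y k - X k) /\<^sub>R t k) \<longlonglongrightarrow> h + 0"
    using assms unfolding tangential_def by (rule tendsto_add)
  then show ?thesis
    unfolding tangential_def by (simp flip: scaleR_add_right)
qed

lemma tangential_tendsto:
  assumes "steps t" "tangential t X x h"
  shows "X \<longlonglongrightarrow> x"
proof -
  have "(\<lambda>k. x + t k *\<^sub>R ((X k - x) /\<^sub>R t k)) \<longlonglongrightarrow> x + 0 *\<^sub>R h"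
    using assms unfolding steps_def tangential_def by (intro tendsto_intros) auto
  then show ?thesis
    using steps_nonzero[OF assms(1)] by simp
qed

lemma tangential_has_derivative:
  assumes t: "steps t" and X: "tangential t X x h" and f: "(f has_derivative D) (at x)"
  shows "tangential t (\<lambda>k. f (X k)) (f x) (D h)"
proof -
  interpret D: bounded_linear D
    using f by (rule has_derivative_bounded_linear)
  obtain e where e: "\<And>k. f (x + k) = f x + D k + e k"
    and lim: "((\<lambda>k. norm (e k) / norm k) \<longlongrightarrow> 0) (at 0)"
    using f unfolding has_derivative_iff_Ex by blast
  have e0: "e 0 = 0" using e[of 0] by (simp add: D.zero)
  have "isCont (\<lambda>k. norm (e k) / norm k) 0"
    using lim by (simp add: isCont_def)
  moreover have "(\<lambda>k. X k - x) \<longlonglongrightarrow> 0"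
    using tangential_tendsto[OF t X] by (simp add: LIM_zero)
  ultimately have "(\<lambda>k. norm (e (X k - x)) / norm (X k - x)) \<longlonglongrightarrow> norm (e 0) / norm (0::'a)"
    by (rule isCont_tendsto_compose)
  then have "(\<lambda>k. norm (e (X k - x)) / norm (X k - x) * norm ((X k - x) /\<^sub>R t k)) \<longlonglongrightarrow> 0 * norm h"
    using X unfolding tangential_def by (intro tendsto_mult tendsto_norm) auto
  moreover have "norm (e (X k - x)) / norm (X k - x) * norm ((X k - x) /\<^sub>R t k)
      = norm (e (X k - x) /\<^sub>R t k)" for k
    by (cases "X k = x") (auto simp: e0)
  ultimately have "(\<lambda>k. norm (e (X k - x) /\<^sub>R t k)) \<longlonglongrightarrow> 0"
    by (simp only: mult_zero_left)
  then have "(\<lambda>k. e (X k - x) /\<^sub>R t k) \<longlonglongrightarrow> 0"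
    by (rule tendsto_norm_zero_cancel)
  moreover have "(\<lambda>k. D ((X k - x) /\<^sub>R t k)) \<longlonglongrightarrow> D h"
    using X unfolding tangential_def by (rule D.tendsto)
  ultimately have "(\<lambda>k. D ((X k - x) /\<^sub>R t k) + e (X k - x) /\<^sub>R t k) \<longlonglongrightarrow> D h + 0"
    by (rule tendsto_add[rotated])
  moreover have "D ((X k - x) /\<^sub>R t k) + e (X k - x) /\<^sub>R t k = (f (X k) - f x) /\<^sub>R t k" for k
    using e[of "X k - x"] by (simp add: D.scaleR flip: scaleR_add_right)
  ultimately show ?thesis
    unfolding tangential_def by simp
qed

lemma (in bounded_bilinear) tangential_prod:
  assumes t: "steps t" and X: "tangential t X x h" and Y: "tangential t Y y k"
  shows "tangential t (\<lambda>n. prod (X n) (Y n)) (prod x y) (prod x k + prod h y)"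
proof -
  have "((\<lambda>p. prod (fst p) (snd p)) has_derivative
      (\<lambda>p. prod (fst (x, y)) (snd p) + prod (fst p) (snd (x, y)))) (at (x, y))"
    by (rule FDERIV) (auto intro!: derivative_eq_intros)
  from tangential_has_derivative[OF t tangential_Pair[OF X Y] this] show ?thesis
    by simp
qed

section \<open>Tangent cones and regular normal cones\<close>

lemma tangent_cone_iff:
  "h \<in> tangent_cone \<Omega> a \<longleftrightarrow> (\<exists>t X. steps t \<and> tangential t X a h \<and> (\<forall>k. X k \<in> \<Omega>))"
proof
  assume "h \<in> tangent_cone \<Omega> a"
  then obtain t w where tw: "\<And>k. t k > 0" "t \<longlonglongrightarrow> 0" "w \<longlonglongrightarrow> h" "\<And>k. a + t k *\<^sub>R w k \<in> \<Omega>"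
    unfolding tangent_cone_def by auto
  have "tangential t (\<lambda>k. a + t k *\<^sub>R w k) a h"
    using tw(1,3) unfolding tangential_def by (simp add: less_imp_neq[symmetric])
  then show "\<exists>t X. steps t \<and> tangential t X a h \<and> (\<forall>k. X k \<in> \<Omega>)"
    using tw unfolding steps_def by blast
next
  assume "\<exists>t X. steps t \<and> tangential t X a h \<and> (\<forall>k. X k \<in> \<Omega>)"
  then obtain t X where tX: "steps t" "tangential t X a h" "\<And>k. X k \<in> \<Omega>"
    by auto
  have "a + t k *\<^sub>R ((X k - a) /\<^sub>R t k) \<in> \<Omega>" for k
    using tX(3)[of k] steps_nonzero[OF tX(1)] by simp
  then show "h \<in> tangent_cone \<Omega> a"
    using tX unfolding tangent_cone_def steps_def tangential_def by blast
qed

text \<open>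
  Membership is only needed from some index on: the sequences may be shifted.
\<close>
lemma tangent_coneI:
  assumes t: "steps t" and X: "tangential t X a h" and ev: "\<forall>\<^sub>F k in sequentially. X k \<in> \<Omega>"
  shows "h \<in> tangent_cone \<Omega> a"
proof -
  obtain N where N: "\<And>k. k \<ge> N \<Longrightarrow> X k \<in> \<Omega>"
    using ev by (auto simp: eventually_sequentially)
  have "strict_mono (\<lambda>k. k + N)" by (simp add: strict_mono_def)
  from steps_subseq[OF t this] tangential_subseq[OF X this] N show ?thesis
    unfolding tangent_cone_iff by (intro exI[of _ "t \<circ> (\<lambda>k. k + N)"] exI[of _ "X \<circ> (\<lambda>k. k + N)"]) auto
qed

lemma tangent_cone_subset_local:
  assumes "open U" "a \<in> U"
  shows "tangent_cone \<Omega> a \<subseteq> tangent_cone (\<Omega> \<inter> U) a"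
proof
  fix h assume "h \<in> tangent_cone \<Omega> a"
  then obtain t X where tX: "steps t" "tangential t X a h" "\<And>k. X k \<in> \<Omega>"
    by (auto simp: tangent_cone_iff)
  have "\<forall>\<^sub>F k in sequentially. X k \<in> U"
    by (rule topological_tendstoD[OF tangential_tendsto[OF tX(1,2)] assms])
  then show "h \<in> tangent_cone (\<Omega> \<inter> U) a"
    by (intro tangent_coneI[OF tX(1,2)]) (use tX(3) in \<open>auto elim: eventually_mono\<close>)
qed

text \<open>
  The inclusion from right to left is where convexity enters: for \<open>x = s (w - z)\<close> with \<open>w \<in> C\<close>,
  the point \<open>z + t x\<close> stays in \<open>C\<close> as long as \<open>t s \<le> 1\<close>.
\<close>
lemma tangent_cone_convex:
  assumes C: "convex C" and z: "z \<in> C"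
  shows "tangent_cone C z = closure (cone hull ((\<lambda>w. w - z) ` C))"
proof
  show "tangent_cone C z \<subseteq> closure (cone hull ((\<lambda>w. w - z) ` C))"
  proof
    fix h assume "h \<in> tangent_cone C z"
    then obtain t X where tX: "steps t" "tangential t X z h" "\<And>k. X k \<in> C"
      by (auto simp: tangent_cone_iff)
    have "(X k - z) /\<^sub>R t k \<in> cone hull ((\<lambda>w. w - z) ` C)" for k
      unfolding cone_hull_expl using tX(3) steps_pos[OF tX(1), of k]
      by (auto intro!: exI[of _ "inverse (t k)"] exI[of _ "X k - z"])
    then show "h \<in> closure (cone hull ((\<lambda>w. w - z) ` C))"
      using tX(2) unfolding closure_sequential tangential_def
      by (intro exI[of _ "\<lambda>k. (X k - z) /\<^sub>R t k"]) blast
  qed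
  show "closure (cone hull ((\<lambda>w. w - z) ` C)) \<subseteq> tangent_cone C z"
  proof
    fix h assume "h \<in> closure (cone hull ((\<lambda>w. w - z) ` C))"
    then obtain x where x: "\<And>k. x k \<in> cone hull ((\<lambda>w. w - z) ` C)" "x \<longlonglongrightarrow> h"
      unfolding closure_sequential by blast
    have "\<exists>s w. s \<ge> 0 \<and> w \<in> C \<and> x k = s *\<^sub>R (w - z)" for k
      using x(1)[of k] unfolding cone_hull_expl by auto
    then obtain s w where sw: "\<And>k. s k \<ge> 0" "\<And>k. w k \<in> C" "\<And>k. x k = s k *\<^sub>R (w k - z)"
      by metis
    \<comment> \<open>the first term makes the steps vanish, the second gives \<open>t k * s k \<le> 1\<close>\<close>
    define t where "t k = min (1 / real (Suc k)) (1 / (1 + s k))" for k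
    have tpos: "t k > 0" for k
      using sw(1)[of k] by (simp add: t_def)
    have "t \<longlonglongrightarrow> 0"
      using steps_harmonic tpos unfolding steps_def
      by (intro tendsto_sandwich[of "\<lambda>_. 0" t sequentially "\<lambda>k. 1 / real (Suc k)"])
         (auto simp: t_def less_imp_le)
    moreover have "z + t k *\<^sub>R x k \<in> C" for k
    proof -
      have "t k * s k \<le> 1 / (1 + s k) * s k"
        using sw(1)[of k] by (intro mult_right_mono) (auto simp: t_def)
      also have "\<dots> \<le> 1" using sw(1)[of k] by (simp add: field_simps)
      finally have "(1 - t k * s k) *\<^sub>R z + (t k * s k) *\<^sub>R w k \<in> C"
        using sw(1)[of k] sw(2)[of k] tpos[of k] z
        by (intro convexD[OF C]) auto
      also have "(1 - t k * s k) *\<^sub>R z + (t k * s k) *\<^sub>R w k = z + t k *\<^sub>R x k"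
        by (simp add: sw(3) algebra_simps)
      finally show ?thesis .
    qed
    ultimately show "h \<in> tangent_cone C z"
      unfolding tangent_cone_def using tpos x(2) by blast
  qed
qed

lemma
  assumes "convex C" "z \<in> C"
  shows closed_tangent_cone: "closed (tangent_cone C z)"
    and convex_tangent_cone: "convex (tangent_cone C z)"
    and cone_tangent_cone: "cone (tangent_cone C z)"
    and zero_in_tangent_cone: "0 \<in> tangent_cone C z"
proof -
  have eq: "tangent_cone C z = closure (cone hull ((\<lambda>w. w - z) ` C))"
    using assms by (rule tangent_cone_convex)
  have "convex ((\<lambda>w. w - z) ` C)"
    using assms(1) by (rule convex_translation_subtract)
  then show "convex (tangent_cone C z)"
    unfolding eq by (intro convex_closure convex_cone_hull)
  show "closed (tangent_cone C z)"
    unfolding eq by simp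
  show cone: "cone (tangent_cone C z)"
    unfolding eq by (intro cone_closure cone_cone_hull)
  have "tangent_cone C z \<noteq> {}"
    using assms(2) unfolding eq by (auto simp: cone_hull_empty_iff[symmetric])
  then show "0 \<in> tangent_cone C z"
    using cone unfolding cone_def by (metis equals0I order_refl scaleR_zero_left)
qed

lemma lin_convex_cone:
  assumes "convex K" "cone K" "K \<noteq> {}"
  shows "lin K = K \<inter> uminus ` K"
  unfolding lin_def
proof (rule Greatest_equality)
  have add: "x + y \<in> K" if "x \<in> K" "y \<in> K" for x y
    using assms(1,2) that convex_cone[of K] by blast
  have mul: "c *\<^sub>R x \<in> K" if "x \<in> K" "c \<ge> 0" for c x
    using assms(2) that by (simp add: cone_def)
  have mem: "x \<in> K \<inter> uminus ` K \<longleftrightarrow> x \<in> K \<and> - x \<in> K" for x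
    by (metis Int_iff image_iff minus_minus)
  have "c *\<^sub>R x \<in> K \<and> - (c *\<^sub>R x) \<in> K" if "x \<in> K" "- x \<in> K" for c x
  proof (cases "c \<ge> 0")
    case True
    then show ?thesis using mul[OF that(1), of c] mul[OF that(2), of c] by simp
  next
    case False
    then show ?thesis using mul[OF that(1), of "- c"] mul[OF that(2), of "- c"] by simp
  qed
  moreover have "0 \<in> K" using mul[of _ 0] assms(3) by auto
  moreover have "- (x + y) \<in> K" if "- x \<in> K" "- y \<in> K" for x y
    using add[OF that] by simp
  ultimately show "subspace (K \<inter> uminus ` K) \<and> K \<inter> uminus ` K \<subseteq> K"
    unfolding subspace_def mem using add by auto
next
  fix L assume "subspace L \<and> L \<subseteq> K"
  then show "L \<subseteq> K \<inter> uminus ` K"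
    using subspace_neg[of L] by (metis Int_iff image_eqI minus_minus subset_iff)
qed

lemma regular_normal_cone_iff:
  "v \<in> regular_normal_cone \<Omega> y \<longleftrightarrow>
     y \<in> \<Omega> \<and> (\<forall>\<epsilon>>0. \<forall>\<^sub>F u in at y within \<Omega>. v \<bullet> (u - y) \<le> \<epsilon> * norm (u - y))"
proof (cases "y \<in> \<Omega>")
  case True
  let ?q = "\<lambda>u. v \<bullet> (u - y) / norm (u - y)"
  have "v \<in> regular_normal_cone \<Omega> y \<longleftrightarrow> (\<forall>c>0. \<forall>\<^sub>F u in at y within \<Omega>. ereal (?q u) < c)"
    using True by (simp add: regular_normal_cone_def Limsup_le_iff)
  also have "\<dots> \<longleftrightarrow> (\<forall>\<epsilon>>0. \<forall>\<^sub>F u in at y within \<Omega>. v \<bullet> (u - y) \<le> \<epsilon> * norm (u - y))"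
  proof safe
    fix \<epsilon> :: real assume "\<forall>c>0. \<forall>\<^sub>F u in at y within \<Omega>. ereal (?q u) < c" "\<epsilon> > 0"
    then have "\<forall>\<^sub>F u in at y within \<Omega>. ?q u < \<epsilon>" by (auto dest: spec[of _ "ereal \<epsilon>"])
    then show "\<forall>\<^sub>F u in at y within \<Omega>. v \<bullet> (u - y) \<le> \<epsilon> * norm (u - y)"
      using eventually_neq_at_within[of y y \<Omega>]
      by eventually_elim (auto simp: divide_simps split: if_splits)
  next
    fix c :: ereal assume *: "\<forall>\<epsilon>>0. \<forall>\<^sub>F u in at y within \<Omega>. v \<bullet> (u - y) \<le> \<epsilon> * norm (u - y)" "c > 0"
    obtain \<epsilon> where \<epsilon>: "\<epsilon> > 0" "ereal \<epsilon> < c"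
      using ereal_dense2[OF *(2)] by (auto simp: zero_ereal_def)
    have "\<forall>\<^sub>F u in at y within \<Omega>. v \<bullet> (u - y) \<le> \<epsilon> * norm (u - y)"
      using * \<epsilon> by blast
    then show "\<forall>\<^sub>F u in at y within \<Omega>. ereal (?q u) < c"
      using eventually_neq_at_within[of y y \<Omega>]
    proof eventually_elim
      case (elim u)
      then have "?q u \<le> \<epsilon>" by (auto simp: divide_simps)
      then show ?case using \<epsilon>(2) by (meson ereal_less_eq(3) le_less_trans)
    qed
  qed
  finally show ?thesis using True by simp
qed (simp add: regular_normal_cone_def)

lemma regular_normal_tangent_le:
  assumes v: "v \<in> regular_normal_cone \<Omega> a" and h: "h \<in> tangent_cone \<Omega> a"
  shows "v \<bullet> h \<le> 0"
proof -
  obtain t X where tX: "steps t" "tangential t X a h" "\<And>k. X k \<in> \<Omega>"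
    using h by (auto simp: tangent_cone_iff)
  have "v \<bullet> h \<le> \<epsilon> * norm h" if "\<epsilon> > 0" for \<epsilon>
  proof (rule tendsto_le[OF sequentially_bot])
    show "(\<lambda>k. \<epsilon> * norm ((X k - a) /\<^sub>R t k)) \<longlonglongrightarrow> \<epsilon> * norm h"
      "(\<lambda>k. v \<bullet> ((X k - a) /\<^sub>R t k)) \<longlonglongrightarrow> v \<bullet> h"
      using tX(2) unfolding tangential_def by (intro tendsto_intros; simp)+
    obtain d where d: "d > 0"
      "\<And>u. u \<in> \<Omega> \<Longrightarrow> u \<noteq> a \<Longrightarrow> dist u a < d \<Longrightarrow> v \<bullet> (u - a) \<le> \<epsilon> * norm (u - a)"
      using v \<open>\<epsilon> > 0\<close> unfolding regular_normal_cone_iff eventually_at by metis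
    have "\<forall>\<^sub>F k in sequentially. dist (X k) a < d"
      using tangential_tendsto[OF tX(1,2)] \<open>d > 0\<close> by (rule tendstoD)
    then show "\<forall>\<^sub>F k in sequentially. v \<bullet> ((X k - a) /\<^sub>R t k) \<le> \<epsilon> * norm ((X k - a) /\<^sub>R t k)"
    proof eventually_elim
      case (elim k)
      have "v \<bullet> (X k - a) \<le> \<epsilon> * norm (X k - a)"
        using d(2)[OF tX(3) _ elim] by (cases "X k = a") auto
      then show ?case
        using steps_pos[OF tX(1), of k] by (simp add: divide_simps)
    qed
  qed
  then have le: "\<forall>\<^sub>F \<epsilon> in at_right 0. v \<bullet> h \<le> \<epsilon> * norm h"
    by (auto simp: eventually_at_filter)
  have "((\<lambda>\<epsilon>. \<epsilon> * norm h) \<longlongrightarrow> 0 * norm h) (at_right 0)"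
    by (intro tendsto_intros)
  from tendsto_lowerbound[OF this le] show ?thesis by simp
qed

lemma normal_cone_subset_regular:
  "normal_cone C z \<subseteq> regular_normal_cone C z"
proof
  fix v assume v: "v \<in> normal_cone C z"
  then have z: "z \<in> C" and le: "\<And>u. u \<in> C \<Longrightarrow> v \<bullet> (u - z) \<le> 0"
    by (auto simp: normal_cone_def split: if_splits)
  have "v \<bullet> (u - z) \<le> \<epsilon> * norm (u - z)" if "u \<in> C" "\<epsilon> > 0" for u and \<epsilon> :: real
    using le[OF that(1)] that(2) by (meson less_imp_le mult_nonneg_nonneg norm_ge_zero order_trans)
  then show "v \<in> regular_normal_cone C z"
    using z unfolding regular_normal_cone_iff by (auto simp: eventually_at_filter)
qed

lemma closest_point_normal_cone:
  assumes C: "closed C" "convex C" and z: "z \<in> C"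
  shows "closest_point C (z + w) = z \<longleftrightarrow> w \<in> normal_cone C z"
proof
  assume eq: "closest_point C (z + w) = z"
  have "w \<bullet> (u - z) \<le> 0" if "u \<in> C" for u
    using closest_point_dot[OF C(2,1) that, of "z + w"] by (simp add: eq)
  then show "w \<in> normal_cone C z" using z by (simp add: normal_cone_def)
next
  assume "w \<in> normal_cone C z"
  then have le: "\<And>u. u \<in> C \<Longrightarrow> w \<bullet> (u - z) \<le> 0"
    using z by (auto simp: normal_cone_def)
  have "dist (z + w) z \<le> dist (z + w) u" if "u \<in> C" for u
  proof -
    have "(norm w)\<^sup>2 \<le> (norm w)\<^sup>2 - 2 * (w \<bullet> (u - z)) + (norm (u - z))\<^sup>2"
      using le[OF that] zero_le_power2[of "norm (u - z)"] by linarith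
    also have "\<dots> = (norm (w - (u - z)))\<^sup>2"
      by (simp add: power2_norm_eq_inner inner_diff_left inner_diff_right inner_commute algebra_simps)
    finally have "norm w \<le> norm (w - (u - z))"
      by (rule power2_le_imp_le) simp
    then show ?thesis by (simp add: dist_norm algebra_simps)
  qed
  then show "closest_point C (z + w) = z"
    using closest_point_unique[OF C(2,1) z, of "z + w"] by simp
qed

text \<open>
  Since the projection is nonexpansive, its directional derivative also governs sequences that
  approach \<open>x\<close> along curves tangent to \<open>h\<close>.
\<close>
lemma tangential_closest_point:
  assumes C: "closed C" "convex C" "C \<noteq> {}"
    and t: "steps t" and X: "tangential t X x h"
    and d: "has_dir_derivative (closest_point C) x h d"
  shows "tangential t (\<lambda>k. closest_point C (X k)) (closest_point C x) d"
proof -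
  let ?P = "closest_point C"
  have ft: "filterlim t (at_right 0) sequentially"
    using t unfolding steps_def filterlim_at by (auto simp: eventually_sequentially less_imp_neq[symmetric])
  have ray: "tangential t (\<lambda>k. ?P (x + t k *\<^sub>R h)) (?P x) d"
    using filterlim_compose[OF d[unfolded has_dir_derivative_def] ft] unfolding tangential_def .
  have "(\<lambda>k. norm ((X k - x) /\<^sub>R t k - h)) \<longlonglongrightarrow> 0"
    using X unfolding tangential_def by (simp add: LIM_zero tendsto_norm_zero)
  then have "(\<lambda>k. (?P (X k) - ?P (x + t k *\<^sub>R h)) /\<^sub>R t k) \<longlonglongrightarrow> 0"
  proof (rule Lim_null_comparison[rotated], intro always_eventually allI)
    fix k
    have "norm (?P (X k) - ?P (x + t k *\<^sub>R h)) \<le> norm (X k - (x + t k *\<^sub>R h))"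
      using closest_point_lipschitz[OF C(2,1,3)] by (simp add: dist_norm)
    also have "X k - (x + t k *\<^sub>R h) = t k *\<^sub>R ((X k - x) /\<^sub>R t k - h)"
      using steps_nonzero[OF t, of k] by (simp add: algebra_simps)
    finally show "norm ((?P (X k) - ?P (x + t k *\<^sub>R h)) /\<^sub>R t k) \<le> norm ((X k - x) /\<^sub>R t k - h)"
      using steps_pos[OF t, of k] by (simp add: divide_simps mult.commute)
  qed
  with ray show ?thesis by (rule tangential_perturb)
qed

section \<open>Solving equations near a surjective derivative\<close>

text \<open>
  Strict differentiability of \<open>F\<close> at \<open>a\<close>: the linear map \<open>D\<close> approximates the increments of \<open>F\<close>
  between any two points near \<open>a\<close>. This is what makes the local solvability estimates uniform in
  the base point.
\<close>
definition strict_derivative ::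
  "('a::real_normed_vector \<Rightarrow> 'b::real_normed_vector) \<Rightarrow> ('a \<Rightarrow> 'b) \<Rightarrow> 'a \<Rightarrow> bool" where
  "strict_derivative F D a \<longleftrightarrow> linear D \<and>
     (\<forall>\<epsilon>>0. \<exists>\<delta>>0. \<forall>x\<in>ball a \<delta>. \<forall>y\<in>ball a \<delta>.
        norm (F x - F y - D (x - y)) \<le> \<epsilon> * norm (x - y))"

lemma strict_derivativeE:
  assumes "strict_derivative F D a" "\<epsilon> > 0"
  obtains \<delta> where "\<delta> > 0" "\<And>x y. x \<in> ball a \<delta> \<Longrightarrow> y \<in> ball a \<delta> \<Longrightarrow>
    norm (F x - F y - D (x - y)) \<le> \<epsilon> * norm (x - y)"
  using assms unfolding strict_derivative_def by blast

lemma C1_strict_derivative: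
  assumes U: "open U" "a \<in> U"
    and der: "\<And>x. x \<in> U \<Longrightarrow> (F has_derivative blinfun_apply (F' x)) (at x)"
    and cont: "continuous_on U F'"
  shows "strict_derivative F (F' a) a"
  unfolding strict_derivative_def
proof (intro conjI allI impI)
  show "linear (blinfun_apply (F' a))"
    by (rule bounded_linear.linear[OF blinfun.bounded_linear_right])
  fix \<epsilon> :: real assume "\<epsilon> > 0"
  have "(F' \<longlongrightarrow> F' a) (at a)"
    using cont U by (simp add: continuous_on_eq_continuous_at isCont_def)
  then have "\<forall>\<^sub>F x in at a. dist (F' x) (F' a) < \<epsilon>"
    using \<open>\<epsilon> > 0\<close> by (rule tendstoD)
  then obtain d where d: "d > 0" "\<And>x. x \<noteq> a \<Longrightarrow> dist x a < d \<Longrightarrow> dist (F' x) (F' a) < \<epsilon>"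
    unfolding eventually_at by auto
  obtain e where e: "e > 0" "ball a e \<subseteq> U" using U open_contains_ball by blast
  have "norm (F x - F y - F' a (x - y)) \<le> \<epsilon> * norm (x - y)"
    if xy: "x \<in> ball a (min d e)" "y \<in> ball a (min d e)" for x y
  proof -
    have "norm ((F x - F' a x) - (F y - F' a y)) \<le> \<epsilon> * norm (x - y)"
    proof (rule differentiable_bound[where S = "ball a (min d e)"])
      fix z assume z: "z \<in> ball a (min d e)"
      then have "z \<in> U" using e(2) by auto
      have "((\<lambda>x. F x - F' a x) has_derivative (\<lambda>h. F' z h - F' a h)) (at z)"
        using der[OF \<open>z \<in> U\<close>]
          bounded_linear_imp_has_derivative[OF blinfun.bounded_linear_right, of "F' a" "at z"]
        by (rule has_derivative_diff)
      moreover have "blinfun_apply (F' z - F' a) = (\<lambda>h. F' z h - F' a h)"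
        by (simp add: fun_eq_iff blinfun.diff_left)
      ultimately show "((\<lambda>x. F x - F' a x) has_derivative blinfun_apply (F' z - F' a))
          (at z within ball a (min d e))"
        by (simp add: has_derivative_at_withinI)
      have "norm (F' z - F' a) \<le> \<epsilon>"
        using d(2)[of z] z \<open>\<epsilon> > 0\<close> by (cases "z = a") (auto simp: dist_norm norm_minus_commute)
      then show "onorm (blinfun_apply (F' z - F' a)) \<le> \<epsilon>"
        by (simp add: norm_blinfun.rep_eq)
    qed (use xy in auto)
    then show ?thesis by (simp add: blinfun.diff_right algebra_simps)
  qed
  then show "\<exists>\<delta>>0. \<forall>x\<in>ball a \<delta>. \<forall>y\<in>ball a \<delta>. norm (F x - F y - F' a (x - y)) \<le> \<epsilon> * norm (x - y)"
    using d(1) e(1) by (intro exI[of _ "min d e"]) auto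
qed

lemma C1_locally_Lipschitz:
  assumes "open U" "a \<in> U"
    and "\<And>x. x \<in> U \<Longrightarrow> (F has_derivative blinfun_apply (F' x)) (at x)"
    and "continuous_on U F'"
  obtains L \<delta> where "\<delta> > 0"
    "\<And>x y. x \<in> ball a \<delta> \<Longrightarrow> y \<in> ball a \<delta> \<Longrightarrow> norm (F x - F y) \<le> L * norm (x - y)"
proof -
  have "strict_derivative F (F' a) a" using assms by (rule C1_strict_derivative)
  then obtain \<delta> where \<delta>: "\<delta> > 0" "\<And>x y. x \<in> ball a \<delta> \<Longrightarrow> y \<in> ball a \<delta> \<Longrightarrow>
      norm (F x - F y - F' a (x - y)) \<le> 1 * norm (x - y)"
    using strict_derivativeE[of F "F' a" a 1] by auto
  show ?thesis
  proof (rule that[OF \<delta>(1)])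
    fix x y assume "x \<in> ball a \<delta>" "y \<in> ball a \<delta>"
    from \<delta>(2)[OF this] norm_blinfun[of "F' a" "x - y"]
      norm_triangle_ineq[of "F x - F y - F' a (x - y)" "F' a (x - y)"]
    show "norm (F x - F y) \<le> (1 + norm (F' a)) * norm (x - y)"
      by (simp add: algebra_simps)
  qed
qed

text \<open>
  A quantitative Lyusternik-Graves step. The correction is sought in the form \<open>B p\<close> with \<open>B\<close> a
  right inverse of \<open>D\<close> on the subspace \<open>E\<close>, as the fixed point of \<open>p \<mapsto> p - (F (a + B p) - \<tau>)\<close>; the
  iteration stays in \<open>E\<close> because \<open>F\<close> takes its values there.
\<close>
lemma solve_by_contraction:
  fixes F :: "'a::real_normed_vector \<Rightarrow> 'b::euclidean_space"
  assumes strict: "\<And>x y. x \<in> ball c \<delta> \<Longrightarrow> y \<in> ball c \<delta> \<Longrightarrow>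
      norm (F x - F y - D (x - y)) \<le> \<epsilon> * norm (x - y)"
    and B: "linear B" "\<And>p. norm (B p) \<le> M * norm p"
    and \<epsilon>M: "M > 0" "\<epsilon> \<ge> 0" "\<epsilon> * M \<le> 1 / 2"
    and E: "subspace E" "\<And>e. e \<in> E \<Longrightarrow> D (B e) = e" "\<And>x. x \<in> ball c \<delta> \<Longrightarrow> F x \<in> E" "\<tau> \<in> E"
    and a: "2 * M * norm (F a - \<tau>) < \<delta> - dist c a"
  shows "\<exists>p\<in>E. norm p \<le> 2 * norm (F a - \<tau>) \<and> F (a + B p) = \<tau>"
proof -
  define r where "r = 2 * norm (F a - \<tau>)"
  define K where "K = E \<inter> cball 0 r"
  define \<Phi> where "\<Phi> p = p - (F (a + B p) - \<tau>)" for p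
  have r: "r \<ge> 0" by (simp add: r_def)
  have inball: "a + B p \<in> ball c \<delta>" if "p \<in> K" for p
  proof -
    have "norm p \<le> r" using that by (simp add: K_def)
    then have "norm (B p) \<le> M * r"
      using B(2)[of p] mult_left_mono[of "norm p" r M] \<epsilon>M(1) by linarith
    then have "norm (B p) < \<delta> - dist c a" using a by (simp add: r_def)
    moreover have "dist c (a + B p) \<le> dist c a + norm (B p)"
      using dist_triangle[of c "a + B p" a] by (simp add: dist_norm)
    ultimately show ?thesis by simp
  qed
  have contr: "norm (\<Phi> p - \<Phi> q) \<le> 1 / 2 * norm (p - q)" if pq: "p \<in> K" "q \<in> K" for p q
  proof -
    have "p - q \<in> E" using pq E(1) by (auto simp: K_def intro: subspace_diff)
    then have "\<Phi> p - \<Phi> q = - (F (a + B p) - F (a + B q) - D ((a + B p) - (a + B q)))"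
      using E(2)[of "p - q"] by (simp add: \<Phi>_def linear_diff[OF B(1)])
    then have "norm (\<Phi> p - \<Phi> q) \<le> \<epsilon> * norm (B (p - q))"
      using strict[OF inball[OF pq(1)] inball[OF pq(2)]]
      by (simp add: norm_minus_commute linear_diff[OF B(1)])
    also have "\<dots> \<le> \<epsilon> * (M * norm (p - q))"
      by (intro mult_left_mono B \<epsilon>M)
    also have "\<dots> \<le> 1 / 2 * norm (p - q)"
      using mult_right_mono[OF \<epsilon>M(3), of "norm (p - q)"] by simp
    finally show ?thesis .
  qed
  have K0: "0 \<in> K" using E(1) r by (auto simp: K_def subspace_0)
  have "\<exists>!p\<in>K. \<Phi> p = p"
  proof (rule Banach_fix[where c = "1 / 2"])
    show "complete K"
      unfolding K_def by (intro complete_eq_closed[THEN iffD2] closed_Int closed_subspace E(1) closed_cball)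
    show "\<Phi> ` K \<subseteq> K"
    proof safe
      fix p assume p: "p \<in> K"
      have "\<Phi> p \<in> E"
        using p E(1,4) E(3)[OF inball[OF p]] unfolding \<Phi>_def K_def
        by (auto intro!: subspace_diff)
      moreover have "norm (\<Phi> p) \<le> r"
      proof -
        have "norm (\<Phi> p) \<le> norm (\<Phi> p - \<Phi> 0) + norm (\<Phi> 0)"
          by (metis diff_add_cancel norm_triangle_ineq)
        also have "norm (\<Phi> 0) = r / 2"
          by (simp add: \<Phi>_def r_def linear_0[OF B(1)] norm_minus_commute)
        also have "norm (\<Phi> p - \<Phi> 0) + r / 2 \<le> 1 / 2 * norm p + r / 2"
          using contr[OF p K0] by simp
        also have "\<dots> \<le> r" using p by (simp add: K_def)
        finally show ?thesis .
      qed
      ultimately show "\<Phi> p \<in> K" by (simp add: K_def)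
    qed
  qed (use K0 contr in \<open>auto simp: dist_norm\<close>)
  then obtain p where "p \<in> K" "\<Phi> p = p" by blast
  then show ?thesis by (auto simp: K_def \<Phi>_def r_def)
qed

lemma right_inverse_on:
  fixes D :: "'a::euclidean_space \<Rightarrow> 'b::euclidean_space"
  assumes "linear D" "range D = E"
  obtains B M where "linear B" "M > 0" "\<And>p. norm (B p) \<le> M * norm p" "\<And>e. e \<in> E \<Longrightarrow> D (B e) = e"
proof -
  obtain B where B: "linear B" "\<forall>e\<in>D ` UNIV. D (B e) = e"
    using linear_exists_right_inverse_on[OF assms(1) subspace_UNIV] by blast
  moreover obtain M where "M > 0" "\<And>p. norm (B p) \<le> M * norm p"
    using linear_bounded_pos[OF B(1)] by blast
  ultimately show ?thesis using that[of B M] assms(2) by auto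
qed

text \<open>
  The equation \<open>F x = \<tau>\<close> can be solved near every \<open>a\<close> close to \<open>c\<close>, at a distance from \<open>a\<close>
  proportional to the residual, with one constant \<open>M\<close>. The range of \<open>D\<close> may be a proper subspace
  \<open>E\<close>, provided that \<open>F\<close> maps into \<open>E\<close>.
\<close>
lemma metric_regularity:
  fixes F :: "'a::euclidean_space \<Rightarrow> 'b::euclidean_space"
  assumes strict: "strict_derivative F D c" and range: "range D = E"
    and U: "open U" "c \<in> U" "F ` U \<subseteq> E"
  obtains \<delta> M where "\<delta> > 0" "M > 0" "ball c \<delta> \<subseteq> U"
    "\<And>a \<tau>. \<tau> \<in> E \<Longrightarrow> M * norm (F a - \<tau>) < \<delta> - dist c a \<Longrightarrow>
       \<exists>x. F x = \<tau> \<and> norm (x - a) \<le> M * norm (F a - \<tau>)"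
proof -
  have D: "linear D" using strict by (simp add: strict_derivative_def)
  then have E: "subspace E" using range linear_subspace_image[OF D subspace_UNIV] by simp
  obtain B M where B: "linear B" "M > 0" "\<And>p. norm (B p) \<le> M * norm p" "\<And>e. e \<in> E \<Longrightarrow> D (B e) = e"
    using right_inverse_on[OF D range] by blast
  obtain d where d: "d > 0"
    "\<And>x y. x \<in> ball c d \<Longrightarrow> y \<in> ball c d \<Longrightarrow>
       norm (F x - F y - D (x - y)) \<le> 1 / (2 * M) * norm (x - y)"
    using strict_derivativeE[OF strict, of "1 / (2 * M)"] \<open>M > 0\<close> by auto
  obtain e where e: "e > 0" "ball c e \<subseteq> U" using U open_contains_ball by blast
  have d': "norm (F x - F y - D (x - y)) \<le> 1 / (2 * M) * norm (x - y)"
    if "x \<in> ball c (min d e)" "y \<in> ball c (min d e)" for x y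
    using d(2) that by simp
  have FE: "F x \<in> E" if "x \<in> ball c (min d e)" for x
    using that e(2) U(3) by (auto simp: subset_iff)
  show ?thesis
  proof (rule that[of "min d e" "2 * M"])
    fix a \<tau> assume \<tau>: "\<tau> \<in> E" "2 * M * norm (F a - \<tau>) < min d e - dist c a"
    have "\<exists>p\<in>E. norm p \<le> 2 * norm (F a - \<tau>) \<and> F (a + B p) = \<tau>"
      by (rule solve_by_contraction[where D = D and \<epsilon> = "1 / (2 * M)" and M = M, OF d' B(1,3,2)])
         (use \<tau> FE B(2,4) E in auto)
    then obtain p where p: "norm p \<le> 2 * norm (F a - \<tau>)" "F (a + B p) = \<tau>" by blast
    have "norm (B p) \<le> M * (2 * norm (F a - \<tau>))"
      using B(3)[of p] mult_left_mono[OF p(1), of M] \<open>M > 0\<close> by linarith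
    with p(2) show "\<exists>x. F x = \<tau> \<and> norm (x - a) \<le> 2 * M * norm (F a - \<tau>)"
      by (intro exI[of _ "a + B p"]) simp
  qed (use d(1) e B(2) in auto)
qed

text \<open>
  If \<open>F (A\<^sub>k)\<close> agrees with \<open>T\<^sub>k\<close> to first order, then \<open>A\<close> can be changed by \<open>o(t\<^sub>k)\<close> so that the
  agreement is exact.
\<close>
lemma correct_tangential:
  assumes reg: "\<And>a \<tau>. \<tau> \<in> E \<Longrightarrow> M * norm (F a - \<tau>) < \<delta> - dist c a \<Longrightarrow>
       \<exists>x. F x = \<tau> \<and> norm (x - a) \<le> M * norm (F a - \<tau>)"
    and a: "a \<in> ball c \<delta>"
    and t: "steps t" and A: "tangential t A a h"
    and FA: "tangential t (\<lambda>k. F (A k)) b d" and T: "tangential t T b d"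
    and TE: "\<forall>\<^sub>F k in sequentially. T k \<in> E"
  obtains X where "tangential t X a h" "\<forall>\<^sub>F k in sequentially. F (X k) = T k"
proof -
  define X where "X k = (SOME x. F x = T k \<and> norm (x - A k) \<le> M * norm (F (A k) - T k))" for k
  have "(\<lambda>k. \<delta> - dist c (A k) - M * norm (F (A k) - T k)) \<longlonglongrightarrow> \<delta> - dist c a - M * norm (b - b)"
    by (intro tendsto_intros tangential_tendsto[OF t FA] tangential_tendsto[OF t T] tangential_tendsto[OF t A])
  then have "\<forall>\<^sub>F k in sequentially. 0 < \<delta> - dist c (A k) - M * norm (F (A k) - T k)"
    by (rule order_tendstoD) (use a in simp)
  then have "\<forall>\<^sub>F k in sequentially. M * norm (F (A k) - T k) < \<delta> - dist c (A k)"
    by eventually_elim simp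
  with TE have X: "\<forall>\<^sub>F k in sequentially. F (X k) = T k \<and> norm (X k - A k) \<le> M * norm (F (A k) - T k)"
  proof eventually_elim
    case (elim k)
    from reg[OF elim] show ?case unfolding X_def by (rule someI_ex)
  qed
  have "(\<lambda>k. M * norm ((F (A k) - b) /\<^sub>R t k - (T k - b) /\<^sub>R t k)) \<longlonglongrightarrow> M * norm (d - d)"
    using FA T unfolding tangential_def by (intro tendsto_intros)
  then have lim: "(\<lambda>k. M * norm ((F (A k) - b) /\<^sub>R t k - (T k - b) /\<^sub>R t k)) \<longlonglongrightarrow> 0"
    by simp
  have "(\<lambda>k. (X k - A k) /\<^sub>R t k) \<longlonglongrightarrow> 0"
  proof (rule Lim_null_comparison[OF _ lim])
    show "\<forall>\<^sub>F k in sequentially.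
        norm ((X k - A k) /\<^sub>R t k) \<le> M * norm ((F (A k) - b) /\<^sub>R t k - (T k - b) /\<^sub>R t k)"
      using X
    proof eventually_elim
      case (elim k)
      have "(F (A k) - b) /\<^sub>R t k - (T k - b) /\<^sub>R t k = (F (A k) - T k) /\<^sub>R t k"
        by (simp flip: scaleR_diff_right)
      then show ?case
        using elim steps_pos[OF t, of k] by (simp add: divide_simps)
    qed
  qed
  then have "tangential t X a h" by (rule tangential_perturb[OF A])
  moreover have "\<forall>\<^sub>F k in sequentially. F (X k) = T k"
    using X by eventually_elim simp
  ultimately show ?thesis by (rule that)
qed

lemma derivative_in_subspace:
  fixes F :: "'a::real_normed_vector \<Rightarrow> 'b::euclidean_space"
  assumes U: "open U" "a \<in> U" "F ` U \<subseteq> E" and E: "subspace E"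
    and F: "(F has_derivative D) (at a)"
  shows "D h \<in> E"
proof -
  let ?t = "\<lambda>k. 1 / real (Suc k)"
  have t: "steps ?t" by (rule steps_harmonic)
  have X: "tangential ?t (\<lambda>k. a + ?t k *\<^sub>R h) a h" by (rule tangential_ray[OF t])
  show ?thesis
  proof (rule Lim_in_closed_set)
    show "(\<lambda>k. (F (a + ?t k *\<^sub>R h) - F a) /\<^sub>R ?t k) \<longlonglongrightarrow> D h"
      using tangential_has_derivative[OF t X F] unfolding tangential_def .
    have "\<forall>\<^sub>F k in sequentially. a + ?t k *\<^sub>R h \<in> U"
      by (rule topological_tendstoD[OF tangential_tendsto[OF t X] U(1,2)])
    then show "\<forall>\<^sub>F k in sequentially. (F (a + ?t k *\<^sub>R h) - F a) /\<^sub>R ?t k \<in> E"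
      by eventually_elim (use U in \<open>auto intro!: subspace_scale subspace_diff E\<close>)
  qed (use E in \<open>auto intro: closed_subspace\<close>)
qed

text \<open>
  Surjectivity onto \<open>E\<close> persists near \<open>c\<close>, with solutions bounded uniformly in the operator.
\<close>
lemma nearby_operators_onto:
  fixes F' :: "'a::metric_space \<Rightarrow> 'b::euclidean_space \<Rightarrow>\<^sub>L 'c::euclidean_space"
  assumes U: "open U" "c \<in> U" and cont: "continuous_on U F'"
    and range: "range (F' c) = E" and rangeU: "\<And>a h. a \<in> U \<Longrightarrow> F' a h \<in> E"
  obtains \<delta> M where "\<delta> > 0" "M > 0" "ball c \<delta> \<subseteq> U"
    "\<And>a e. a \<in> ball c \<delta> \<Longrightarrow> e \<in> E \<Longrightarrow> \<exists>h. F' a h = e \<and> norm h \<le> M * norm e"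
proof -
  have D: "linear (blinfun_apply (F' c))"
    by (rule bounded_linear.linear[OF blinfun.bounded_linear_right])
  then have E: "subspace E" using range linear_subspace_image[OF D subspace_UNIV] by simp
  obtain B M where B: "linear B" "M > 0" "\<And>p. norm (B p) \<le> M * norm p"
    "\<And>e. e \<in> E \<Longrightarrow> F' c (B e) = e"
    using right_inverse_on[OF D range] by blast
  have "(F' \<longlongrightarrow> F' c) (at c)"
    using cont U by (simp add: continuous_on_eq_continuous_at isCont_def)
  then have "\<forall>\<^sub>F x in at c. dist (F' x) (F' c) < 1 / (2 * M)"
    using \<open>M > 0\<close> by (intro tendstoD) auto
  then obtain d where d: "d > 0" "\<And>x. x \<noteq> c \<Longrightarrow> dist x c < d \<Longrightarrow> dist (F' x) (F' c) < 1 / (2 * M)"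
    unfolding eventually_at by auto
  obtain e where e: "e > 0" "ball c e \<subseteq> U" using U open_contains_ball by blast
  show ?thesis
  proof (rule that[of "min d e" "2 * M"])
    fix a \<tau> assume a: "a \<in> ball c (min d e)" and \<tau>: "\<tau> \<in> E"
    have close: "norm (F' a - F' c) \<le> 1 / (2 * M)"
      using d(2)[of a] a \<open>M > 0\<close>
      by (cases "a = c") (auto simp: dist_norm[of "F' a"] dist_commute[of a])
    have near: "norm (F' a x - F' a y - F' c (x - y)) \<le> 1 / (2 * M) * norm (x - y)" for x y
    proof -
      have "F' a x - F' a y - F' c (x - y) = (F' a - F' c) (x - y)"
        by (simp add: blinfun.diff_left blinfun.diff_right)
      also have "norm \<dots> \<le> norm (F' a - F' c) * norm (x - y)" by (rule norm_blinfun)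
      finally show ?thesis
        using mult_right_mono[OF close, of "norm (x - y)"] by simp
    qed
    \<comment> \<open>the operator is linear, so every radius is admissible; this one exceeds \<open>2 * M * norm \<tau>\<close>\<close>
    have "\<exists>p\<in>E. norm p \<le> 2 * norm (F' a 0 - \<tau>) \<and> F' a (0 + B p) = \<tau>"
      by (rule solve_by_contraction[where D = "F' c" and \<epsilon> = "1 / (2 * M)" and M = M and c = 0
              and \<delta> = "2 * M * norm \<tau> + 1", OF near B(1,3,2)])
         (use \<tau> a e rangeU B(2,4) E in \<open>auto simp: blinfun.zero_right\<close>)
    then obtain p where p: "norm p \<le> 2 * norm \<tau>" "F' a (B p) = \<tau>"
      by (auto simp: blinfun.zero_right)
    have "norm (B p) \<le> M * (2 * norm \<tau>)"
      using B(3)[of p] mult_left_mono[OF p(1), of M] \<open>M > 0\<close> by linarith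
    with p(2) show "\<exists>h. F' a h = \<tau> \<and> norm h \<le> 2 * M * norm \<tau>"
      by (intro exI[of _ "B p"]) simp
  qed (use d(1) e B(2) in auto)
qed

section \<open>Regular normals of a preimage under a submersion\<close>

text \<open>
  A functional that vanishes on the kernel of \<open>T\<close> is in the range of the adjoint. The preimage is
  chosen inside the range \<open>E\<close> of \<open>T\<close>, where it is unique and controlled by its image.
\<close>
lemma vanishing_on_kernel_imp_adj:
  fixes T :: "'a::euclidean_space \<Rightarrow>\<^sub>L 'b::euclidean_space"
  assumes E: "subspace E" and range: "range T = E" and ker: "\<And>h. T h = 0 \<Longrightarrow> v \<bullet> h = 0"
  obtains \<mu> where "\<mu> \<in> E" "v = adj T \<mu>"
proof -
  have T: "linear (blinfun_apply T)"
    by (rule bounded_linear.linear[OF blinfun.bounded_linear_right])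
  obtain B where B: "linear B" "\<And>e. e \<in> E \<Longrightarrow> T (B e) = e"
    by (rule right_inverse_on[OF T range]) blast
  obtain \<mu> \<nu> where \<mu>: "\<mu> \<in> span E" "\<And>w. w \<in> span E \<Longrightarrow> orthogonal \<nu> w" "adjoint B v = \<mu> + \<nu>"
    using orthogonal_subspace_decomp_exists by blast
  have "h \<bullet> v = h \<bullet> adj T \<mu>" for h
  proof -
    have Th: "T h \<in> E" using range by auto
    have "T (h - B (T h)) = 0" using B(2)[OF Th] by (simp add: blinfun.diff_right)
    then have "h \<bullet> v = B (T h) \<bullet> v" using ker[of "h - B (T h)"] by (simp add: inner_diff_right inner_commute)
    also have "\<dots> = T h \<bullet> adjoint B v" by (simp add: adjoint_works[OF B(1)])
    also have "\<dots> = T h \<bullet> \<mu>"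
      using \<mu>(2)[OF span_base[OF Th]] by (simp add: \<mu>(3) inner_add_right orthogonal_def inner_commute)
    finally show ?thesis by (simp add: inner_adj)
  qed
  then have "v = adj T \<mu>" using vector_eq_ldot by blast
  moreover have "\<mu> \<in> E" using \<mu>(1) E by (metis span_eq_iff)
  ultimately show ?thesis using that by blast
qed

lemma norm_le_adj_onto:
  fixes T :: "'a::euclidean_space \<Rightarrow>\<^sub>L 'b::euclidean_space"
  assumes "T h = \<mu>" "norm h \<le> M * norm \<mu>"
  shows "norm \<mu> \<le> M * norm (adj T \<mu>)"
proof -
  have "norm \<mu> * norm \<mu> = h \<bullet> adj T \<mu>"
    using assms(1) by (simp add: inner_adj flip: power2_norm_eq_inner power2_eq_square)
  also have "\<dots> \<le> norm h * norm (adj T \<mu>)" by (rule norm_cauchy_schwarz)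
  also have "\<dots> \<le> (M * norm \<mu>) * norm (adj T \<mu>)" by (intro mult_right_mono assms) simp
  finally have "norm \<mu> * norm \<mu> \<le> norm \<mu> * (M * norm (adj T \<mu>))" by (simp add: algebra_simps)
  then show ?thesis
    using assms by (cases "\<mu> = 0") (auto simp: mult_le_cancel_left adj.zero_right)
qed

text \<open>
  The normal cone calculus at all points near \<open>c\<close>, with a uniform bound on the multiplier. If
  \<open>F a + F' a h \<in> \<Xi>\<close>, then \<open>h\<close> is tangent to \<open>\<Omega> = F\<^sup>-\<^sup>1(\<Xi>)\<close> by metric regularity, so a
  regular normal \<open>v\<close> satisfies \<open>v \<bullet> h \<le> 0\<close>. Taking \<open>h\<close> in the kernel of \<open>F' a\<close> gives
  \<open>v = adj (F' a) \<mu>\<close>, and taking \<open>F' a h = \<xi> - F a\<close> gives \<open>\<mu> \<in> N\<^sub>\<Xi>(F a)\<close>.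
\<close>
lemma regular_normals_of_preimage:
  fixes F :: "'a::euclidean_space \<Rightarrow> 'b::euclidean_space"
  assumes U: "open U" "c \<in> U" "F ` U \<subseteq> E"
    and der: "\<And>x. x \<in> U \<Longrightarrow> (F has_derivative blinfun_apply (F' x)) (at x)"
    and cont: "continuous_on U F'"
    and range: "range (F' c) = E"
    and \<Omega>: "\<And>x. x \<in> U \<Longrightarrow> x \<in> \<Omega> \<longleftrightarrow> F x \<in> \<Xi>" and \<Xi>: "convex \<Xi>" "\<Xi> \<subseteq> E"
  obtains \<delta> M where "\<delta> > 0" "M > 0" "ball c \<delta> \<subseteq> U"
    "\<And>a v. a \<in> ball c \<delta> \<Longrightarrow> v \<in> regular_normal_cone \<Omega> a \<Longrightarrow>
       \<exists>\<mu>\<in>E. \<mu> \<in> normal_cone \<Xi> (F a) \<and> v = adj (F' a) \<mu>"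
    "\<And>a \<mu>. a \<in> ball c \<delta> \<Longrightarrow> \<mu> \<in> E \<Longrightarrow> norm \<mu> \<le> M * norm (adj (F' a) \<mu>)"
proof -
  have "linear (blinfun_apply (F' c))"
    by (rule bounded_linear.linear[OF blinfun.bounded_linear_right])
  then have E: "subspace E" using range linear_subspace_image[OF _ subspace_UNIV, of "F' c"] by simp
  have rangeU: "F' a h \<in> E" if "a \<in> U" for a h
    by (rule derivative_in_subspace[OF U(1) that U(3) E der[OF that]])
  obtain \<delta>1 M1 where reg: "\<delta>1 > 0" "M1 > 0" "ball c \<delta>1 \<subseteq> U"
    "\<And>a \<tau>. \<tau> \<in> E \<Longrightarrow> M1 * norm (F a - \<tau>) < \<delta>1 - dist c a \<Longrightarrow>
       \<exists>x. F x = \<tau> \<and> norm (x - a) \<le> M1 * norm (F a - \<tau>)"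
    using metric_regularity[OF C1_strict_derivative[OF U(1,2) der cont] range U] by blast
  obtain \<delta>2 M2 where onto: "\<delta>2 > 0" "M2 > 0" "ball c \<delta>2 \<subseteq> U"
    "\<And>a e. a \<in> ball c \<delta>2 \<Longrightarrow> e \<in> E \<Longrightarrow> \<exists>h. F' a h = e \<and> norm h \<le> M2 * norm e"
    using nearby_operators_onto[OF U(1,2) cont range rangeU] by blast
  show ?thesis
  proof (rule that[of "min \<delta>1 \<delta>2" M2])
    fix a v assume a: "a \<in> ball c (min \<delta>1 \<delta>2)" and v: "v \<in> regular_normal_cone \<Omega> a"
    have aU: "a \<in> U" using a reg(3) by auto
    have "a \<in> \<Omega>" using v by (simp add: regular_normal_cone_iff)
    then have Fa: "F a \<in> \<Xi>" using \<Omega>[OF aU] by simp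
    have ontoa: "\<exists>h. F' a h = e" if "e \<in> E" for e
      using onto(4)[OF _ that, of a] a by auto
    have le: "v \<bullet> h \<le> 0" if h: "F a + F' a h \<in> \<Xi>" for h
    proof -
      let ?t = "\<lambda>k. 1 / real (Suc k)"
      have t: "steps ?t" by (rule steps_harmonic)
      have ray: "tangential ?t (\<lambda>k. a + ?t k *\<^sub>R h) a h" by (rule tangential_ray[OF t])
      have T: "F a + ?t k *\<^sub>R F' a h \<in> \<Xi>" for k
        using convexD_alt[OF \<Xi>(1) Fa h, of "?t k"] by (simp add: algebra_simps)
      have TE: "\<forall>\<^sub>F k in sequentially. F a + ?t k *\<^sub>R F' a h \<in> E"
        using T \<Xi>(2) by (intro always_eventually) blast
      obtain X where X: "tangential ?t X a h"
        "\<forall>\<^sub>F k in sequentially. F (X k) = F a + ?t k *\<^sub>R F' a h"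
        by (rule correct_tangential[OF reg(4) _ t ray tangential_has_derivative[OF t ray der[OF aU]]
              tangential_ray[OF t] TE]) (use a in auto)
      have "\<forall>\<^sub>F k in sequentially. X k \<in> U"
        by (rule topological_tendstoD[OF tangential_tendsto[OF t X(1)] U(1) aU])
      with X(2) have "\<forall>\<^sub>F k in sequentially. X k \<in> \<Omega>"
        by eventually_elim (use \<Omega> T in auto)
      then show ?thesis
        by (rule regular_normal_tangent_le[OF v tangent_coneI[OF t X(1)]])
    qed
    obtain \<mu> where \<mu>: "\<mu> \<in> E" "v = adj (F' a) \<mu>"
    proof (rule vanishing_on_kernel_imp_adj[OF E])
      show "range (F' a) = E" using rangeU[OF aU] ontoa by (auto simp: image_iff) metis
      show "v \<bullet> h = 0" if "F' a h = 0" for h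
        using le[of h] le[of "- h"] that Fa by (simp add: blinfun.minus_right)
    qed
    have "\<mu> \<bullet> (\<xi> - F a) \<le> 0" if \<xi>: "\<xi> \<in> \<Xi>" for \<xi>
    proof -
      have "\<xi> - F a \<in> E" using \<Xi>(2) \<xi> Fa by (intro subspace_diff[OF E]) auto
      then obtain h where h: "F' a h = \<xi> - F a" using ontoa by blast
      then show ?thesis
        using le[of h] \<xi> by (simp add: \<mu>(2) inner_commute inner_adj)
    qed
    then have "\<mu> \<in> normal_cone \<Xi> (F a)" using Fa by (simp add: normal_cone_def)
    with \<mu> show "\<exists>\<mu>\<in>E. \<mu> \<in> normal_cone \<Xi> (F a) \<and> v = adj (F' a) \<mu>" by blast
  next
    fix a \<mu> assume "a \<in> ball c (min \<delta>1 \<delta>2)" "\<mu> \<in> E"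
    then obtain h where "F' a h = \<mu>" "norm h \<le> M2 * norm \<mu>"
      using onto(4)[of a \<mu>] by auto
    then show "norm \<mu> \<le> M2 * norm (adj (F' a) \<mu>)" by (rule norm_le_adj_onto)
  qed (use reg onto in auto)
qed

text \<open>
  The reverse inclusion needs no constraint qualification.
\<close>
lemma adj_normal_cone_subset_regular:
  fixes g :: "'a::euclidean_space \<Rightarrow> 'b::euclidean_space"
  assumes g: "(g has_derivative blinfun_apply T) (at y)" and lam: "lam \<in> normal_cone C (g y)"
    and U: "open U" "y \<in> U" and \<Omega>: "\<And>x. x \<in> U \<Longrightarrow> x \<in> \<Omega> \<longleftrightarrow> g x \<in> C"
  shows "adj T lam \<in> regular_normal_cone \<Omega> y"
  unfolding regular_normal_cone_iff
proof (intro conjI allI impI)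
  have gy: "g y \<in> C" and le: "\<And>u. u \<in> C \<Longrightarrow> lam \<bullet> (u - g y) \<le> 0"
    using lam by (auto simp: normal_cone_def split: if_splits)
  show "y \<in> \<Omega>" using gy \<Omega>[OF U(2)] by simp
  fix \<epsilon> :: real assume "\<epsilon> > 0"
  define e where "e = \<epsilon> / (norm lam + 1)"
  have e: "e > 0" "norm lam * e \<le> \<epsilon>"
    using \<open>\<epsilon> > 0\<close> by (simp_all add: e_def add_nonneg_pos pos_divide_le_eq distrib_left add_pos_nonneg)
  obtain d where d: "d > 0"
    "\<And>u. norm (u - y) < d \<Longrightarrow> norm (g u - g y - T (u - y)) \<le> e * norm (u - y)"
    using g e(1) unfolding has_derivative_at_alt by blast
  obtain r where r: "r > 0" "ball y r \<subseteq> U" using U open_contains_ball by blast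
  have "adj T lam \<bullet> (u - y) \<le> \<epsilon> * norm (u - y)" if u: "u \<in> \<Omega>" "dist u y < min d r" for u
  proof -
    have "u \<in> ball y r" using u(2) by (simp add: dist_commute)
    then have gu: "g u \<in> C" using \<Omega>[of u] r(2) u(1) by blast
    have "adj T lam \<bullet> (u - y) = lam \<bullet> (g u - g y) - lam \<bullet> (g u - g y - T (u - y))"
      by (simp add: inner_commute inner_adj inner_diff_left inner_diff_right)
    also have "\<dots> \<le> norm lam * norm (g u - g y - T (u - y))"
      using le[of "g u"] gu Cauchy_Schwarz_ineq2[of lam "g u - g y - T (u - y)"] by simp
    also have "\<dots> \<le> norm lam * (e * norm (u - y))"
      using d(2)[of u] u(2) by (intro mult_left_mono) (auto simp: dist_norm)
    also have "\<dots> \<le> \<epsilon> * norm (u - y)"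
      using mult_right_mono[OF e(2), of "norm (u - y)"] by simp
    finally show ?thesis .
  qed
  then show "\<forall>\<^sub>F u in at y within \<Omega>. adj T lam \<bullet> (u - y) \<le> \<epsilon> * norm (u - y)"
    unfolding eventually_at using d(1) r(1) by (intro exI[of _ "min d r"]) auto
qed

lemma regular_normal_cone_convex:
  assumes "convex C" "v \<in> regular_normal_cone C z"
  shows "v \<in> normal_cone C z"
proof -
  have z: "z \<in> C" using assms(2) by (simp add: regular_normal_cone_iff)
  have "v \<bullet> (u - z) \<le> 0" if u: "u \<in> C" for u
  proof (rule regular_normal_tangent_le[OF assms(2) tangent_coneI])
    show "steps (\<lambda>k. 1 / real (Suc k))" by (rule steps_harmonic)
    then show "tangential (\<lambda>k. 1 / real (Suc k)) (\<lambda>k. z + (1 / real (Suc k)) *\<^sub>R (u - z)) z (u - z)"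
      by (rule tangential_ray)
    have "z + (1 / real (Suc k)) *\<^sub>R (u - z) \<in> C" for k
      using convexD_alt[OF assms(1) z u, of "1 / real (Suc k)"] by (simp add: algebra_simps)
    then show "\<forall>\<^sub>F k in sequentially. z + (1 / real (Suc k)) *\<^sub>R (u - z) \<in> C" by simp
  qed
  with z show ?thesis by (simp add: normal_cone_def)
qed

section \<open>Multipliers of the constraint system\<close>

text \<open>
  The constraint \<open>g y \<in> \<Theta>\<close> near a reference point \<open>yb\<close>, together with a reduction of \<open>\<Theta>\<close> near
  \<open>g yb\<close> to the convex set \<open>\<Xi>\<close> by means of \<open>\<eta>\<close>. Both \<open>\<eta>\<close> and \<open>\<eta> \<circ> g\<close> have derivatives onto the
  subspace \<open>E\<close> carrying \<open>\<Xi>\<close>; for \<open>\<eta> \<circ> g\<close> this is what nondegeneracy and pointedness yield.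
  The derivatives of \<open>g\<close> and \<open>\<eta>\<close> are \<open>g'\<close> and \<open>\<eta>'\<close>, and \<open>D2g\<close> is the derivative of \<open>g'\<close> at
  \<open>yb\<close>.
\<close>
locale reduced_constraint =
  fixes g :: "'y::euclidean_space \<Rightarrow> 'z::euclidean_space"
    and g' :: "'y \<Rightarrow> 'y \<Rightarrow>\<^sub>L 'z" and D2g :: "'y \<Rightarrow> 'y \<Rightarrow>\<^sub>L 'z"
    and \<Theta> :: "'z set"
    and \<eta> :: "'z \<Rightarrow> 'q::euclidean_space" and \<eta>' :: "'z \<Rightarrow> 'z \<Rightarrow>\<^sub>L 'q"
    and V :: "'z set" and E \<Xi> :: "'q set"
    and yb :: 'y
  assumes g_der: "\<And>y. (g has_derivative blinfun_apply (g' y)) (at y)"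
    and g'_cont: "continuous_on UNIV g'"
    and g'_der: "(g' has_derivative D2g) (at yb)"
    and \<Theta>: "closed \<Theta>" "convex \<Theta>"
    and V: "open V" "g yb \<in> V"
    and \<eta>_der: "\<And>z. z \<in> V \<Longrightarrow> (\<eta> has_derivative blinfun_apply (\<eta>' z)) (at z)"
    and \<eta>'_C1: "C1_on V \<eta>'"
    and \<eta>_E: "\<eta> ` V \<subseteq> E"
    and range_\<eta>': "range (\<eta>' (g yb)) = E"
    and range_\<eta>'_g': "range (\<lambda>h. \<eta>' (g yb) (g' yb h)) = E"
    and \<Theta>_iff: "\<And>z. z \<in> V \<Longrightarrow> z \<in> \<Theta> \<longleftrightarrow> \<eta> z \<in> \<Xi>"
    and \<Xi>: "convex \<Xi>" "\<Xi> \<subseteq> E"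
begin

abbreviation F :: "'y \<Rightarrow> 'q" where "F y \<equiv> \<eta> (g y)"
abbreviation F' :: "'y \<Rightarrow> 'y \<Rightarrow>\<^sub>L 'q" where "F' y \<equiv> \<eta>' (g y) o\<^sub>L g' y"
abbreviation U :: "'y set" where "U \<equiv> g -` V"

lemma cont_g: "continuous_on UNIV g"
  using g_der by (meson continuous_at_imp_continuous_on has_derivative_continuous)

lemma U: "open U" "yb \<in> U" "F ` U \<subseteq> E"
  using open_vimage[OF V(1) cont_g] V(2) \<eta>_E by auto

lemma cont_\<eta>': "continuous_on V \<eta>'"
  using \<eta>'_C1 unfolding C1_on_def
  by (meson continuous_at_imp_continuous_on has_derivative_continuous)

lemma \<eta>'_has_derivative: "\<exists>D. (\<eta>' has_derivative blinfun_apply D) (at (g yb))"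
  using \<eta>'_C1 V unfolding C1_on_def by blast

lemma F_der: "y \<in> U \<Longrightarrow> (F has_derivative blinfun_apply (F' y)) (at y)"
  using diff_chain_at[OF g_der[of y] \<eta>_der[of "g y"]] by (simp add: o_def blinfun_compose.rep_eq)

lemma cont_F': "continuous_on U F'"
proof -
  have "continuous_on U (\<lambda>y. \<eta>' (g y))"
    by (rule continuous_on_compose2[OF cont_\<eta>']) (use cont_g in \<open>auto intro: continuous_on_subset\<close>)
  then show ?thesis
    by (rule bounded_bilinear.continuous_on[OF bounded_bilinear_blinfun_compose])
      (use g'_cont in \<open>auto intro: continuous_on_subset\<close>)
qed

lemma range_F': "range (F' yb) = E"
  using range_\<eta>'_g' by simp

lemma pullback_normal:
  assumes "z \<in> V" "\<mu> \<in> normal_cone \<Xi> (\<eta> z)"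
  shows "adj (\<eta>' z) \<mu> \<in> normal_cone \<Theta> z"
  by (rule regular_normal_cone_convex[OF \<Theta>(2)])
     (rule adj_normal_cone_subset_regular[OF \<eta>_der[OF assms(1)] assms(2) V(1) assms(1) \<Theta>_iff])

lemma graph_iff:
  "(x, y) \<in> gph (solution_map f (g -` \<Theta>)) \<longleftrightarrow> - f (x, y) \<in> regular_normal_cone (g -` \<Theta>) y"
proof -
  have "0 = f (x, y) + w \<longleftrightarrow> w = - f (x, y)" for w by (metis add_eq_0_iff)
  then show ?thesis unfolding gph_def solution_map_def by (simp add: image_iff)
qed

lemma
  assumes lamb: "lamb \<in> normal_cone \<Theta> (g yb)"
  shows closed_critical_cone: "closed (critical_cone \<Theta> (g yb) lamb)"
    and convex_critical_cone: "convex (critical_cone \<Theta> (g yb) lamb)"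
    and zero_in_critical_cone: "0 \<in> critical_cone \<Theta> (g yb) lamb"
proof -
  have z: "g yb \<in> \<Theta>" using lamb by (auto simp: normal_cone_def split: if_splits)
  note T = closed_tangent_cone[OF \<Theta>(2) z] convex_tangent_cone[OF \<Theta>(2) z]
    zero_in_tangent_cone[OF \<Theta>(2) z]
  show "closed (critical_cone \<Theta> (g yb) lamb)" "convex (critical_cone \<Theta> (g yb) lamb)"
    "0 \<in> critical_cone \<Theta> (g yb) lamb"
    using T unfolding critical_cone_def
    by (auto intro!: closed_Int convex_Int closed_hyperplane convex_hyperplane)
qed

text \<open>
  The projection derivation condition, applied to sequences that approach \<open>g yb + lamb\<close> along a
  curve: their projections onto \<open>\<Theta>\<close> leave \<open>g yb\<close> in the direction of the projection onto the
  critical cone.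
\<close>
lemma tangential_projection:
  assumes lamb: "lamb \<in> normal_cone \<Theta> (g yb)" and PDC: "PDC \<Theta> (g yb)"
    and t: "steps t" and W: "tangential t W (g yb + lamb) h"
  shows "tangential t (\<lambda>k. closest_point \<Theta> (W k)) (g yb)
           (closest_point (critical_cone \<Theta> (g yb) lamb) h)"
proof -
  have z: "g yb \<in> \<Theta>" using lamb by (auto simp: normal_cone_def split: if_splits)
  have "has_dir_derivative (closest_point \<Theta>) (g yb + lamb) h
      (closest_point (critical_cone \<Theta> (g yb) lamb) h)"
    using PDC lamb unfolding PDC_def by blast
  moreover have "closest_point \<Theta> (g yb + lamb) = g yb"
    using closest_point_normal_cone[OF \<Theta> z] lamb by blast
  ultimately show ?thesis
    using tangential_closest_point[OF \<Theta> _ t W] z by fastforce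
qed

lemma normal_critical_iff:
  assumes lamb: "lamb \<in> normal_cone \<Theta> (g yb)"
  shows "w \<in> normal_cone (critical_cone \<Theta> (g yb) lamb) d \<longleftrightarrow>
           closest_point (critical_cone \<Theta> (g yb) lamb) (d + w) = d"
proof -
  let ?K = "critical_cone \<Theta> (g yb) lamb"
  have K: "closed ?K" "convex ?K" "?K \<noteq> {}"
    using closed_critical_cone[OF lamb] convex_critical_cone[OF lamb] zero_in_critical_cone[OF lamb]
    by auto
  show ?thesis
  proof (cases "d \<in> ?K")
    case True
    then show ?thesis using closest_point_normal_cone[OF K(1,2)] by blast
  next
    case False
    moreover have "closest_point ?K (d + w) \<in> ?K" using K(1,3) by (rule closest_point_in_set)
    ultimately show ?thesis by (auto simp: normal_cone_def)
  qed
qed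

section \<open>The graphical derivative of the solution map\<close>

text \<open>
  The points \<open>y\<^sub>k\<close> on the graph carry reduced multipliers \<open>\<mu>\<^sub>k \<in> E\<close> with
  \<open>-f(x\<^sub>k, y\<^sub>k) = adj (F' y\<^sub>k) \<mu>\<^sub>k\<close>. The uniform bound on multipliers makes the difference quotients
  of \<open>\<mu>\<^sub>k\<close> bounded, so along a subsequence the multipliers \<open>adj (\<eta>' (g y\<^sub>k)) \<mu>\<^sub>k \<in> N\<^sub>\<Theta>(g y\<^sub>k)\<close>
  have a first-order expansion \<open>lamb + t\<^sub>k w + o(t\<^sub>k)\<close>.
\<close>
theorem tangent_graph_imp_equation:
  fixes f :: "'x::euclidean_space \<times> 'y \<Rightarrow> 'y"
  assumes f: "(f has_derivative f') (at (xb, yb))"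
    and eq0: "f (xb, yb) + adj (g' yb) lamb = 0"
    and lamb: "lamb \<in> normal_cone \<Theta> (g yb)" and PDC: "PDC \<Theta> (g yb)"
    and uv: "(u, v) \<in> tangent_cone (gph (solution_map f (g -` \<Theta>))) (xb, yb)"
  shows "\<exists>w \<in> normal_cone (critical_cone \<Theta> (g yb) lamb) (g' yb v).
           f' (u, v) + adj (D2g v) lamb + adj (g' yb) w = 0"
proof -
  let ?\<Gamma> = "g -` \<Theta>"
  obtain \<delta> M where \<Gamma>: "\<delta> > 0" "M > 0" "ball yb \<delta> \<subseteq> U"
    "\<And>a v. a \<in> ball yb \<delta> \<Longrightarrow> v \<in> regular_normal_cone ?\<Gamma> a \<Longrightarrow>
       \<exists>\<mu>\<in>E. \<mu> \<in> normal_cone \<Xi> (F a) \<and> v = adj (F' a) \<mu>"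
    "\<And>a \<mu>. a \<in> ball yb \<delta> \<Longrightarrow> \<mu> \<in> E \<Longrightarrow> norm \<mu> \<le> M * norm (adj (F' a) \<mu>)"
  proof (rule regular_normals_of_preimage[OF U F_der cont_F' range_F' _ \<Xi>])
    show "x \<in> ?\<Gamma> \<longleftrightarrow> F x \<in> \<Xi>" if "x \<in> U" for x using \<Theta>_iff that by simp
  qed blast+
  obtain \<mu>b where \<mu>b: "\<mu>b \<in> E" "lamb = adj (\<eta>' (g yb)) \<mu>b"
  proof (rule regular_normals_of_preimage[OF V \<eta>_E \<eta>_der cont_\<eta>' range_\<eta>' \<Theta>_iff \<Xi>])
    fix \<delta> :: real
    assume "\<delta> > 0" "\<And>a v. a \<in> ball (g yb) \<delta> \<Longrightarrow> v \<in> regular_normal_cone \<Theta> a \<Longrightarrow>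
       \<exists>\<mu>\<in>E. \<mu> \<in> normal_cone \<Xi> (\<eta> a) \<and> v = adj (\<eta>' a) \<mu>"
    then show thesis
      using that normal_cone_subset_regular[of \<Theta> "g yb"] lamb by (meson centre_in_ball subsetD)
  qed
  have E: "subspace E"
    using range_F' linear_subspace_image[OF bounded_linear.linear[OF blinfun.bounded_linear_right]
        subspace_UNIV, of "F' yb"] by simp
  have "(u, v) \<in> tangent_cone (gph (solution_map f ?\<Gamma>) \<inter> snd -` ball yb \<delta>) (xb, yb)"
  proof (rule subsetD[OF tangent_cone_subset_local uv])
    show "open (snd -` ball yb \<delta> :: ('x \<times> 'y) set)"
      by (intro open_vimage open_ball continuous_on_snd continuous_on_id)
  qed (use \<open>\<delta> > 0\<close> in simp)
  then obtain t P where t: "steps t" and P: "tangential t P (xb, yb) (u, v)"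
    and PS: "\<And>k. P k \<in> gph (solution_map f ?\<Gamma>) \<inter> snd -` ball yb \<delta>"
    by (auto simp: tangent_cone_iff)
  define Y where "Y k = snd (P k)" for k
  have Yball: "Y k \<in> ball yb \<delta>" and Pn: "- f (P k) \<in> regular_normal_cone ?\<Gamma> (Y k)" for k
    using PS[of k] graph_iff[of "fst (P k)" "Y k" f] by (simp_all add: Y_def)
  have Y: "tangential t Y yb v"
    using tangential_has_derivative[OF t P has_derivative_snd[OF has_derivative_ident]]
    by (simp add: Y_def[abs_def])
  have fP: "tangential t (\<lambda>k. f (P k)) (f (xb, yb)) (f' (u, v))"
    by (rule tangential_has_derivative[OF t P f])
  have gY: "tangential t (\<lambda>k. g (Y k)) (g yb) (g' yb v)"
    by (rule tangential_has_derivative[OF t Y g_der])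
  have g'Y: "tangential t (\<lambda>k. g' (Y k)) (g' yb) (D2g v)"
    by (rule tangential_has_derivative[OF t Y g'_der])
  obtain D where D: "(\<eta>' has_derivative blinfun_apply D) (at (g yb))"
    using \<eta>'_has_derivative by blast
  have \<eta>'gY: "tangential t (\<lambda>k. \<eta>' (g (Y k))) (\<eta>' (g yb)) (D (g' yb v))"
    by (rule tangential_has_derivative[OF t gY D])
  obtain \<mu> where \<mu>: "\<And>k. \<mu> k \<in> E" "\<And>k. \<mu> k \<in> normal_cone \<Xi> (F (Y k))"
    "\<And>k. - f (P k) = adj (F' (Y k)) (\<mu> k)"
    using \<Gamma>(4)[OF Yball Pn] by metis
  define q where "q k = (\<mu> k - \<mu>b) /\<^sub>R t k" for k
  have qE: "q k \<in> E" for k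
    unfolding q_def using \<mu>(1) \<mu>b(1) E by (intro subspace_scale subspace_diff)
  have F'Y: "tangential t (\<lambda>k. F' (Y k)) (F' yb) ((\<eta>' (g yb) o\<^sub>L D2g v) + (D (g' yb v) o\<^sub>L g' yb))"
    by (rule bounded_bilinear.tangential_prod[OF bounded_bilinear_blinfun_compose t \<eta>'gY g'Y])
  \<comment> \<open>apply the multiplier bound to \<open>q\<^sub>k\<close>: \<open>adj (F' y\<^sub>k) q\<^sub>k\<close> is a convergent difference quotient\<close>
  have "Bseq q"
  proof -
    let ?r = "\<lambda>k. - f (P k) - adj (F' (Y k)) \<mu>b"
    have "tangential t ?r (- f (xb, yb) - adj (F' yb) \<mu>b)
        (- f' (u, v) - (adj (F' yb) 0 + adj ((\<eta>' (g yb) o\<^sub>L D2g v) + (D (g' yb v) o\<^sub>L g' yb)) \<mu>b))"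
      by (intro tangential_diff tangential_minus fP adj.tangential_prod[OF t F'Y] tangential_const)
    moreover have "- f (xb, yb) - adj (F' yb) \<mu>b = 0"
      using eq0 by (simp add: adj_compose \<mu>b(2)[symmetric] add_eq_0_iff)
    ultimately have "Bseq (\<lambda>k. ?r k /\<^sub>R t k)"
      unfolding tangential_def by (simp add: convergentI convergent_imp_Bseq)
    moreover have "?r k /\<^sub>R t k = adj (F' (Y k)) (q k)" for k
      by (simp add: \<mu>(3) q_def adj.scaleR_right adj.diff_right)
    ultimately obtain C where C: "\<And>k. norm (adj (F' (Y k)) (q k)) \<le> C"
      unfolding Bseq_def by auto
    have "norm (q k) \<le> M * C" for k
      using \<Gamma>(5)[OF Yball[of k] qE[of k]] mult_left_mono[OF C[of k], of M] \<open>M > 0\<close> by linarith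
    then show ?thesis by (rule BseqI')
  qed
  then have "bounded (range q)" by (simp add: Bseq_eq_bounded)
  then obtain r qb where r: "strict_mono r" and "(q \<circ> r) \<longlonglongrightarrow> qb"
    using bounded_imp_convergent_subsequence by blast
  then have \<mu>r: "tangential (t \<circ> r) (\<mu> \<circ> r) \<mu>b qb"
    unfolding tangential_def by (simp add: q_def o_def)
  have tr: "steps (t \<circ> r)" using t r by (rule steps_subseq)
  define L where "L k = adj (\<eta>' (g (Y k))) (\<mu> k)" for k
  define w where "w = adj (\<eta>' (g yb)) qb + adj (D (g' yb v)) \<mu>b"
  have L: "tangential (t \<circ> r) (L \<circ> r) lamb w"
    using adj.tangential_prod[OF tr tangential_subseq[OF \<eta>'gY r] \<mu>r]
    by (simp add: \<mu>b(2) w_def L_def o_def)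
  have YV: "g (Y k) \<in> V" for k using \<Gamma>(3) Yball[of k] by auto
  have Ln: "L k \<in> normal_cone \<Theta> (g (Y k))" for k
    unfolding L_def by (rule pullback_normal[OF YV \<mu>(2)])
  have proj: "closest_point \<Theta> (g (Y k) + L k) = g (Y k)" for k
    using Ln[of k] closest_point_normal_cone[OF \<Theta>, of "g (Y k)" "L k"]
    by (auto simp: normal_cone_def split: if_splits)
  have "tangential (t \<circ> r) (\<lambda>k. closest_point \<Theta> (((\<lambda>k. g (Y k)) \<circ> r) k + (L \<circ> r) k)) (g yb)
      (closest_point (critical_cone \<Theta> (g yb) lamb) (g' yb v + w))"
    by (intro tangential_projection[OF lamb PDC tr] tangential_add L tangential_subseq gY r)
  moreover have "tangential (t \<circ> r) (\<lambda>k. closest_point \<Theta> (((\<lambda>k. g (Y k)) \<circ> r) k + (L \<circ> r) k))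
      (g yb) (g' yb v)"
    using tangential_subseq[OF gY r] by (simp add: proj o_def)
  ultimately have "closest_point (critical_cone \<Theta> (g yb) lamb) (g' yb v + w) = g' yb v"
    by (rule tangential_unique)
  then have "w \<in> normal_cone (critical_cone \<Theta> (g yb) lamb) (g' yb v)"
    using normal_critical_iff[OF lamb] by blast
  moreover have "f' (u, v) + (adj (g' yb) w + adj (D2g v) lamb) = 0"
  proof (rule tangential_unique)
    show "tangential (t \<circ> r) (\<lambda>k. ((\<lambda>k. f (P k)) \<circ> r) k + adj (((\<lambda>k. g' (Y k)) \<circ> r) k) ((L \<circ> r) k))
        (f (xb, yb) + adj (g' yb) lamb) (f' (u, v) + (adj (g' yb) w + adj (D2g v) lamb))"
      by (intro tangential_add adj.tangential_prod[OF tr] tangential_subseq fP g'Y r L)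
    have "f (P k) + adj (g' (Y k)) (L k) = 0" for k
      using \<mu>(3)[of k] by (simp add: L_def adj_compose neg_eq_iff_add_eq_0)
    then show "tangential (t \<circ> r)
        (\<lambda>k. ((\<lambda>k. f (P k)) \<circ> r) k + adj (((\<lambda>k. g' (Y k)) \<circ> r) k) ((L \<circ> r) k))
        (f (xb, yb) + adj (g' yb) lamb) 0"
      using tangential_const[of "t \<circ> r" 0] by (simp add: eq0)
  qed
  ultimately show ?thesis by (auto simp: algebra_simps)
qed

text \<open>
  The sequence on the graph is built in three steps. Projecting \<open>g yb + lamb + t\<^sub>k (\<nabla>g(yb) v + w)\<close>
  onto \<open>\<Theta>\<close> gives points \<open>Z\<^sub>k\<close> with normals \<open>L\<^sub>k\<close>. As \<open>\<nabla>g(yb)\<close> need not be onto, \<open>Z\<^sub>k = g(Y\<^sub>k)\<close>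
  may be unsolvable; the reduced equation \<open>\<eta>(g(Y\<^sub>k)) = \<eta>(Z\<^sub>k)\<close> is solved instead, and the reduced
  multiplier of \<open>L\<^sub>k\<close> is pushed to the normal \<open>L'\<^sub>k\<close> at \<open>g(Y\<^sub>k)\<close>. Finally \<open>x\<close> is corrected, with
  \<open>Y\<^sub>k\<close> kept fixed, so that the generalized equation holds exactly.
\<close>
theorem equation_imp_tangent_graph:
  fixes f :: "'x::euclidean_space \<times> 'y \<Rightarrow> 'y"
  assumes f: "(f has_derivative f') (at (xb, yb))" "strict_derivative f f' (xb, yb)"
    and surj: "surj (\<lambda>u. f' (u, 0))"
    and eq0: "f (xb, yb) + adj (g' yb) lamb = 0"
    and lamb: "lamb \<in> normal_cone \<Theta> (g yb)" and PDC: "PDC \<Theta> (g yb)"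
    and w: "w \<in> normal_cone (critical_cone \<Theta> (g yb) lamb) (g' yb v)"
    and eq: "f' (u, v) + adj (D2g v) lamb + adj (g' yb) w = 0"
  shows "(u, v) \<in> tangent_cone (gph (solution_map f (g -` \<Theta>))) (xb, yb)"
proof -
  let ?\<Gamma> = "g -` \<Theta>"
  have gyb: "g yb \<in> \<Theta>" using lamb by (auto simp: normal_cone_def split: if_splits)
  define t where "t k = 1 / real (Suc k)" for k
  have t: "steps t" using steps_harmonic by (simp add: t_def[abs_def])
  define W where "W k = (g yb + lamb) + t k *\<^sub>R (g' yb v + w)" for k
  have W: "tangential t W (g yb + lamb) (g' yb v + w)"
    unfolding W_def by (rule tangential_ray[OF t])
  define Z where "Z k = closest_point \<Theta> (W k)" for k
  have Z\<Theta>: "Z k \<in> \<Theta>" for k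
    unfolding Z_def using \<Theta>(1) gyb by (intro closest_point_in_set) auto
  have Z: "tangential t Z (g yb) (g' yb v)"
    using tangential_projection[OF lamb PDC t W] w normal_critical_iff[OF lamb]
    by (simp add: Z_def[abs_def])
  define L where "L k = W k - Z k" for k
  have Ltan: "tangential t L lamb w"
    using tangential_diff[OF W Z] by (simp add: L_def[abs_def])
  have Ln: "L k \<in> normal_cone \<Theta> (Z k)" for k
    using closest_point_normal_cone[OF \<Theta> Z\<Theta>[of k], of "L k"] by (simp add: L_def Z_def)
  obtain \<delta> M where N: "\<delta> > 0" "M > 0" "ball (g yb) \<delta> \<subseteq> V"
    "\<And>a v. a \<in> ball (g yb) \<delta> \<Longrightarrow> v \<in> regular_normal_cone \<Theta> a \<Longrightarrow>
       \<exists>\<mu>\<in>E. \<mu> \<in> normal_cone \<Xi> (\<eta> a) \<and> v = adj (\<eta>' a) \<mu>"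
    "\<And>a \<mu>. a \<in> ball (g yb) \<delta> \<Longrightarrow> \<mu> \<in> E \<Longrightarrow> norm \<mu> \<le> M * norm (adj (\<eta>' a) \<mu>)"
    by (rule regular_normals_of_preimage[OF V \<eta>_E \<eta>_der cont_\<eta>' range_\<eta>' \<Theta>_iff \<Xi>]) blast+
  have Zball: "\<forall>\<^sub>F k in sequentially. Z k \<in> ball (g yb) \<delta>"
    by (rule topological_tendstoD[OF tangential_tendsto[OF t Z]]) (use N(1) in auto)
  define \<mu> where "\<mu> k = (SOME \<mu>. \<mu> \<in> E \<and> \<mu> \<in> normal_cone \<Xi> (\<eta> (Z k)) \<and> L k = adj (\<eta>' (Z k)) \<mu>)" for k
  have \<mu>: "\<mu> k \<in> E \<and> \<mu> k \<in> normal_cone \<Xi> (\<eta> (Z k)) \<and> L k = adj (\<eta>' (Z k)) (\<mu> k)"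
    if "Z k \<in> ball (g yb) \<delta>" for k
  proof -
    have "L k \<in> regular_normal_cone \<Theta> (Z k)"
      using Ln normal_cone_subset_regular by blast
    from N(4)[OF that this]
    have "\<exists>\<mu>. \<mu> \<in> E \<and> \<mu> \<in> normal_cone \<Xi> (\<eta> (Z k)) \<and> L k = adj (\<eta>' (Z k)) \<mu>" by blast
    then show ?thesis unfolding \<mu>_def by (rule someI_ex)
  qed
  obtain \<delta>1 M1 where reg: "\<delta>1 > 0" "M1 > 0" "ball yb \<delta>1 \<subseteq> U"
    "\<And>a \<tau>. \<tau> \<in> E \<Longrightarrow> M1 * norm (F a - \<tau>) < \<delta>1 - dist yb a \<Longrightarrow>
       \<exists>x. F x = \<tau> \<and> norm (x - a) \<le> M1 * norm (F a - \<tau>)"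
    using metric_regularity[OF C1_strict_derivative[OF U(1,2) F_der cont_F'] range_F' U] by blast
  have \<eta>ZE: "\<forall>\<^sub>F k in sequentially. \<eta> (Z k) \<in> E"
    using Zball by eventually_elim (use \<eta>_E N(3) in blast)
  have \<eta>Z: "tangential t (\<lambda>k. \<eta> (Z k)) (F yb) (F' yb v)"
    using tangential_has_derivative[OF t Z \<eta>_der[OF V(2)]] by simp
  have ray: "tangential t (\<lambda>k. yb + t k *\<^sub>R v) yb v" by (rule tangential_ray[OF t])
  obtain Y where Y: "tangential t Y yb v" and FY: "\<forall>\<^sub>F k in sequentially. F (Y k) = \<eta> (Z k)"
    by (rule correct_tangential[OF reg(4) _ t ray
          tangential_has_derivative[OF t ray F_der[OF U(2)]] \<eta>Z \<eta>ZE])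
       (use reg(1) in auto)
  have gY: "tangential t (\<lambda>k. g (Y k)) (g yb) (g' yb v)"
    by (rule tangential_has_derivative[OF t Y g_der])
  have g'Y: "tangential t (\<lambda>k. g' (Y k)) (g' yb) (D2g v)"
    by (rule tangential_has_derivative[OF t Y g'_der])
  define L' where "L' k = adj (\<eta>' (g (Y k))) (\<mu> k)" for k
  obtain D\<eta>' where D\<eta>': "\<And>z. z \<in> V \<Longrightarrow> (\<eta>' has_derivative blinfun_apply (D\<eta>' z)) (at z)"
    "continuous_on V D\<eta>'"
    using \<eta>'_C1 unfolding C1_on_def by blast
  obtain C \<delta>2 where lip: "\<delta>2 > 0"
    "\<And>x y. x \<in> ball (g yb) \<delta>2 \<Longrightarrow> y \<in> ball (g yb) \<delta>2 \<Longrightarrow> norm (\<eta>' x - \<eta>' y) \<le> C * norm (x - y)"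
  proof (rule C1_locally_Lipschitz[OF V D\<eta>'])
    fix L \<delta> :: real
    assume "\<delta> > 0" "\<And>x y. x \<in> ball (g yb) \<delta> \<Longrightarrow> y \<in> ball (g yb) \<delta> \<Longrightarrow>
      norm (\<eta>' x - \<eta>' y) \<le> L * norm (x - y)"
    then show thesis by (rule that)
  qed
  have Zball2: "\<forall>\<^sub>F k in sequentially. Z k \<in> ball (g yb) \<delta>2"
    by (rule topological_tendstoD[OF tangential_tendsto[OF t Z]]) (use lip(1) in auto)
  have gYball2: "\<forall>\<^sub>F k in sequentially. g (Y k) \<in> ball (g yb) \<delta>2"
    by (rule topological_tendstoD[OF tangential_tendsto[OF t gY]]) (use lip(1) in auto)
  have gYV: "\<forall>\<^sub>F k in sequentially. g (Y k) \<in> V"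
    by (rule topological_tendstoD[OF tangential_tendsto[OF t gY] V])
  \<comment> \<open>\<open>L' - L = o(t)\<close>, since \<open>\<eta>'\<close> is locally Lipschitz, \<open>g (Y\<^sub>k) - Z\<^sub>k = o(t\<^sub>k)\<close> and \<open>\<mu>\<close> is bounded\<close>
  have L'tan: "tangential t L' lamb w"
  proof (rule tangential_perturb[OF Ltan])
    have "(\<lambda>k. C * norm ((g (Y k) - g yb) /\<^sub>R t k - (Z k - g yb) /\<^sub>R t k) * (M * norm (L k)))
        \<longlonglongrightarrow> C * norm (g' yb v - g' yb v) * (M * norm lamb)"
      using gY Z unfolding tangential_def
      by (intro tendsto_intros tangential_tendsto[OF t Ltan])
    then have lim: "(\<lambda>k. C * norm ((g (Y k) - g yb) /\<^sub>R t k - (Z k - g yb) /\<^sub>R t k) * (M * norm (L k)))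
        \<longlonglongrightarrow> 0" by simp
    show "(\<lambda>k. (L' k - L k) /\<^sub>R t k) \<longlonglongrightarrow> 0"
    proof (rule Lim_null_comparison[OF _ lim])
      show "\<forall>\<^sub>F k in sequentially. norm ((L' k - L k) /\<^sub>R t k)
          \<le> C * norm ((g (Y k) - g yb) /\<^sub>R t k - (Z k - g yb) /\<^sub>R t k) * (M * norm (L k))"
        using Zball Zball2 gYball2
      proof eventually_elim
        case (elim k)
        note m = \<mu>[OF elim(1)]
        have "norm (L' k - L k) = norm (adj (\<eta>' (g (Y k)) - \<eta>' (Z k)) (\<mu> k))"
          using m by (simp add: L'_def adj.diff_left)
        also have "\<dots> \<le> norm (\<eta>' (g (Y k)) - \<eta>' (Z k)) * norm (\<mu> k)"
          by (rule norm_adj_le)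
        also have "\<dots> \<le> (C * norm (g (Y k) - Z k)) * (M * norm (L k))"
        proof (rule mult_mono)
          show le: "norm (\<eta>' (g (Y k)) - \<eta>' (Z k)) \<le> C * norm (g (Y k) - Z k)"
            by (rule lip(2)[OF elim(3,2)])
          show "norm (\<mu> k) \<le> M * norm (L k)" using N(5)[OF elim(1)] m by metis
          show "0 \<le> C * norm (g (Y k) - Z k)" using le norm_ge_zero order_trans by blast
        qed simp
        finally have "norm (L' k - L k) \<le> C * norm (g (Y k) - Z k) * (M * norm (L k))" .
        moreover have "(g (Y k) - g yb) /\<^sub>R t k - (Z k - g yb) /\<^sub>R t k = (g (Y k) - Z k) /\<^sub>R t k"
          by (simp flip: scaleR_diff_right)
        ultimately show ?case
          using steps_pos[OF t, of k] by (simp add: divide_simps)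
      qed
    qed
  qed
  have L'n: "\<forall>\<^sub>F k in sequentially. adj (g' (Y k)) (L' k) \<in> regular_normal_cone ?\<Gamma> (Y k)"
    using Zball gYV FY
  proof eventually_elim
    case (elim k)
    have "\<mu> k \<in> normal_cone \<Xi> (F (Y k))" using \<mu>[OF elim(1)] elim(3) by simp
    then have "L' k \<in> normal_cone \<Theta> (g (Y k))"
      unfolding L'_def by (rule pullback_normal[OF elim(2)])
    then show ?case
      by (rule adj_normal_cone_subset_regular[OF g_der _ open_UNIV UNIV_I]) simp
  qed
  \<comment> \<open>the second component of \<open>H\<close> forces the correction to leave \<open>Y\<close> unchanged\<close>
  define H where "H p = (f p, snd p)" for p
  define H' where "H' p = (f' p, snd p)" for p :: "'x \<times> 'y"
  have H: "(H has_derivative H') (at (xb, yb))"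
    unfolding H_def[abs_def] H'_def[abs_def]
    by (intro has_derivative_Pair f(1) has_derivative_snd has_derivative_ident)
  have linf': "linear f'" using f(2) by (simp add: strict_derivative_def)
  have Hstrict: "strict_derivative H H' (xb, yb)"
    unfolding strict_derivative_def
  proof (intro conjI allI impI)
    show "linear H'" using H has_derivative_linear by blast
    have *: "norm (H x - H y - H' (x - y)) = norm (f x - f y - f' (x - y))" for x y
      by (simp add: H_def H'_def norm_Pair)
    fix \<epsilon> :: real assume "\<epsilon> > 0"
    then show "\<exists>\<delta>>0. \<forall>x\<in>ball (xb, yb) \<delta>. \<forall>y\<in>ball (xb, yb) \<delta>.
        norm (H x - H y - H' (x - y)) \<le> \<epsilon> * norm (x - y)"
      unfolding * using f(2) unfolding strict_derivative_def by blast
  qed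
  have Hrange: "range H' = UNIV"
  proof (intro equalityI subset_UNIV subsetI)
    fix p :: "'y \<times> 'y"
    have "fst p - f' (0, snd p) \<in> range (\<lambda>u. f' (u, 0))" using surj by simp
    then obtain a where a: "f' (a, 0) = fst p - f' (0, snd p)" by auto
    have "f' (a, snd p) = f' (a, 0) + f' (0, snd p)"
      using linear_add[OF linf', of "(a, 0)" "(0, snd p)"] by simp
    then have "H' (a, snd p) = p" using a by (simp add: H'_def)
    then show "p \<in> range H'" using rangeI[of H' "(a, snd p)"] by simp
  qed
  obtain \<delta>3 M3 where regH: "\<delta>3 > 0"
    "\<And>a \<tau>. \<tau> \<in> UNIV \<Longrightarrow> M3 * norm (H a - \<tau>) < \<delta>3 - dist (xb, yb) a \<Longrightarrow>
       \<exists>x. H x = \<tau> \<and> norm (x - a) \<le> M3 * norm (H a - \<tau>)"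
  proof (rule metric_regularity[OF Hstrict Hrange open_UNIV UNIV_I subset_UNIV])
    fix \<delta> M :: real
    assume "\<delta> > 0" "\<And>a \<tau>. \<tau> \<in> UNIV \<Longrightarrow> M * norm (H a - \<tau>) < \<delta> - dist (xb, yb) a \<Longrightarrow>
       \<exists>x. H x = \<tau> \<and> norm (x - a) \<le> M * norm (H a - \<tau>)"
    then show thesis by (rule that)
  qed
  have A: "tangential t (\<lambda>k. (xb + t k *\<^sub>R u, Y k)) (xb, yb) (u, v)"
    by (intro tangential_Pair tangential_ray t Y)
  have target: "tangential t (\<lambda>k. (- adj (g' (Y k)) (L' k), Y k)) (H (xb, yb)) (H' (u, v))"
  proof -
    have "tangential t (\<lambda>k. (- adj (g' (Y k)) (L' k), Y k))
        (- adj (g' yb) lamb, yb) (- (adj (g' yb) w + adj (D2g v) lamb), v)"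
      by (intro tangential_Pair tangential_minus adj.tangential_prod t g'Y L'tan Y)
    moreover have "- adj (g' yb) lamb = f (xb, yb)" 
      using eq0 unfolding neg_eq_iff_add_eq_0 by (simp add: ac_simps)
    moreover have "- (adj (g' yb) w + adj (D2g v) lamb) = f' (u, v)"
      using eq unfolding neg_eq_iff_add_eq_0 by (simp add: ac_simps)
    ultimately show ?thesis by (simp add: H_def H'_def)
  qed
  have TU: "\<forall>\<^sub>F k in sequentially. (- adj (g' (Y k)) (L' k), Y k) \<in> UNIV" by simp
  obtain P where P: "tangential t P (xb, yb) (u, v)"
    and HP: "\<forall>\<^sub>F k in sequentially. H (P k) = (- adj (g' (Y k)) (L' k), Y k)"
    by (rule correct_tangential[OF regH(2) _ t A tangential_has_derivative[OF t A H] target TU])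
       (use regH(1) in auto)
  have "\<forall>\<^sub>F k in sequentially. P k \<in> gph (solution_map f ?\<Gamma>)"
    using HP L'n
  proof eventually_elim
    case (elim k)
    then have "f (P k) = - adj (g' (Y k)) (L' k)" "snd (P k) = Y k" by (simp_all add: H_def)
    then show ?case using elim(2) graph_iff[of "fst (P k)" "Y k" f] by (metis minus_minus prod.collapse)
  qed
  then show ?thesis by (rule tangent_coneI[OF t P])
qed

end

section \<open>Jacobian matrices and nondegeneracy\<close>

lemma jacobian_mult:
  fixes f :: "real^'a \<Rightarrow> real^'b"
  assumes "(f has_derivative D) (at x)"
  shows "jacobian f (at x) *v h = D h"
  using assms frechet_derivative_at[OF assms] has_derivative_linear[OF assms]
  by (simp add: jacobian_def matrix_works)

lemma transpose_jacobian_mult: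
  fixes f :: "real^'a \<Rightarrow> real^'b"
  assumes "(f has_derivative blinfun_apply T) (at x)"
  shows "transpose (jacobian f (at x)) *v w = adj T w"
proof -
  have "blinfun_apply T = (\<lambda>h. jacobian f (at x) *v h)"
    using jacobian_mult[OF assms] by (simp add: fun_eq_iff)
  then show ?thesis by (simp add: adjoint_matrix)
qed

text \<open>
  The derivative \<open>R\<close> of \<open>\<eta>\<close> maps tangent vectors of \<open>\<Theta>\<close> to tangent vectors of \<open>\<Xi>\<close>. It therefore
  kills the lineality space of the tangent cone, because the tangent cone of \<open>\<Xi>\<close> is pointed.
\<close>
lemma nondegenerate_range_reduction:
  fixes g :: "real^'m \<Rightarrow> real^'l" and \<eta> :: "real^'l \<Rightarrow> real^'q"
  assumes \<Theta>: "convex \<Theta>" "g y \<in> \<Theta>"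
    and nondeg: "nondegenerate g \<Theta> y"
    and g: "(g has_derivative blinfun_apply T) (at y)"
    and \<eta>: "(\<eta> has_derivative blinfun_apply R) (at (g y))"
    and V: "open V" "g y \<in> V" "\<And>w. w \<in> V \<Longrightarrow> w \<in> \<Theta> \<longleftrightarrow> \<eta> w \<in> \<Xi>"
    and pointed: "pointed (tangent_cone \<Xi> (\<eta> (g y)))"
  shows "range (\<lambda>h. R (T h)) = range (blinfun_apply R)"
proof (intro equalityI subsetI)
  fix e assume "e \<in> range (\<lambda>h. R (T h))" then show "e \<in> range (blinfun_apply R)" by auto
next
  fix e assume "e \<in> range (blinfun_apply R)"
  then obtain z where z: "e = R z" by auto
  let ?K = "tangent_cone \<Theta> (g y)"
  have push: "R b \<in> tangent_cone \<Xi> (\<eta> (g y))" if "b \<in> ?K" for b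
  proof -
    have "b \<in> tangent_cone (\<Theta> \<inter> V) (g y)"
      using tangent_cone_subset_local[OF V(1,2)] that by blast
    then obtain t X where tX: "steps t" "tangential t X (g y) b" "\<And>k. X k \<in> \<Theta> \<inter> V"
      by (auto simp: tangent_cone_iff)
    have "tangential t (\<lambda>k. \<eta> (X k)) (\<eta> (g y)) (R b)"
      by (rule tangential_has_derivative[OF tX(1,2) \<eta>])
    then show ?thesis
      by (rule tangent_coneI[OF tX(1)]) (use tX(3) V(3) in \<open>intro always_eventually, blast\<close>)
  qed
  have "z \<in> {jacobian g (at y) *v a + b | a b. b \<in> lin ?K}"
    using nondeg by (simp add: nondegenerate_def)
  then obtain a b where ab: "z = T a + b" "b \<in> lin ?K"
    by (auto simp: jacobian_mult[OF g])
  have "lin ?K = ?K \<inter> uminus ` ?K"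
    using convex_tangent_cone[OF \<Theta>] cone_tangent_cone[OF \<Theta>] zero_in_tangent_cone[OF \<Theta>]
    by (intro lin_convex_cone) auto
  then have "b \<in> ?K" "- b \<in> ?K" using ab(2) by auto
  then have "R b \<in> tangent_cone \<Xi> (\<eta> (g y))" "- R b \<in> tangent_cone \<Xi> (\<eta> (g y))"
    using push[of b] push[of "- b"] by (simp_all add: blinfun.minus_right)
  then have "R b \<in> tangent_cone \<Xi> (\<eta> (g y)) \<inter> uminus ` tangent_cone \<Xi> (\<eta> (g y))"
    by (metis IntI image_eqI minus_minus)
  then have "R b = 0" using pointed unfolding pointed_def by simp
  then have "e = R (T a)" by (simp add: z ab(1) blinfun.add_right)
  then show "e \<in> range (\<lambda>h. R (T h))" by simp
qed

section \<open>Graphical derivative in terms of Jacobians\<close>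

theorem theorem5p3:
  fixes g :: "real^'m \<Rightarrow> real^'l"
    and \<Theta> :: "(real^'l) set"
    and \<Gamma> :: "(real^'m) set"
    and f :: "(real^'n) \<times> (real^'m) \<Rightarrow> real^'m"
    and S :: "real^'n \<Rightarrow> (real^'m) set"
    and xb :: "real^'n" and yb :: "real^'m" and lamb :: "real^'l"
    and E \<Xi> :: "(real^'q) set"
  assumes g_C2: "C2_on UNIV g"
    and Theta: "closed \<Theta>" "convex_cone \<Theta>"
    and Gamma_def: "\<Gamma> = g -` \<Theta>"
    and S_def: "S = solution_map f \<Gamma>"
    and ref_point: "(xb, yb) \<in> gph S"
    and f_smooth: "\<exists>U. (xb, yb) \<in> U \<and> C1_on U f"
    and A1: "C2_reducible_pointed \<Theta> (g yb) E \<Xi>"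
    and A2: "nondegenerate g \<Theta> yb"
    and A3: "\<forall>z h. \<exists>d. has_dir_derivative (closest_point \<Theta>) z h d"
    and PDC: "PDC \<Theta> (g yb)"
    and multiplier: "lamb \<in> normal_cone \<Theta> (g yb)" "lagrangian f g xb yb lamb = 0"
  shows "(\<forall>u. graphical_derivative S (xb, yb) u \<subseteq>
            {v. 0 \<in> (\<lambda>w. jacobian (\<lambda>x. f (x, yb)) (at xb) *v u
                        + jacobian (\<lambda>y. lagrangian f g xb y lamb) (at yb) *v v
                        + transpose (jacobian g (at yb)) *v w)
                    ` normal_cone (critical_cone \<Theta> (g yb) lamb) (jacobian g (at yb) *v v)})
       \<and> (surj (\<lambda>u. jacobian (\<lambda>x. f (x, yb)) (at xb) *v u) \<longrightarrow>
           (\<forall>u. graphical_derivative S (xb, yb) u =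
            {v. 0 \<in> (\<lambda>w. jacobian (\<lambda>x. f (x, yb)) (at xb) *v u
                        + jacobian (\<lambda>y. lagrangian f g xb y lamb) (at yb) *v v
                        + transpose (jacobian g (at yb)) *v w)
                    ` normal_cone (critical_cone \<Theta> (g yb) lamb) (jacobian g (at yb) *v v)}))"
proof -
  have \<Theta>: "closed \<Theta>" "convex \<Theta>" using Theta by (auto simp: convex_cone_def)
  have gyb: "g yb \<in> \<Theta>" using multiplier(1) by (auto simp: normal_cone_def split: if_splits)
  obtain g' where g': "\<And>y. (g has_derivative blinfun_apply (g' y)) (at y)" "C1_on UNIV g'"
    using g_C2 unfolding C2_on_def by auto
  obtain g'' where g'': "\<And>y. (g' has_derivative blinfun_apply (g'' y)) (at y)"
    using g'(2) unfolding C1_on_def by auto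
  obtain V \<eta> where V: "g yb \<in> V" "C2_on V \<eta>" "\<eta> ` V \<subseteq> E" "\<And>w. w \<in> V \<Longrightarrow> w \<in> \<Theta> \<longleftrightarrow> \<eta> w \<in> \<Xi>"
    "pointed (tangent_cone \<Xi> (\<eta> (g yb)))" "range (\<lambda>h. jacobian \<eta> (at (g yb)) *v h) = E"
    and \<Xi>: "convex \<Xi>" "\<Xi> \<subseteq> E"
    using A1 unfolding C2_reducible_pointed_def by auto
  have openV: "open V" using V(2) by (simp add: C2_on_def)
  obtain \<eta>' where \<eta>': "\<And>z. z \<in> V \<Longrightarrow> (\<eta> has_derivative blinfun_apply (\<eta>' z)) (at z)" "C1_on V \<eta>'"
    using V(2) unfolding C2_on_def by auto
  have range\<eta>': "range (\<eta>' (g yb)) = E"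
    using V(6) jacobian_mult[OF \<eta>'(1)[OF V(1)]] by simp
  interpret reduced_constraint g g' "blinfun_apply (g'' yb)" \<Theta> \<eta> \<eta>' V E \<Xi> yb
  proof
    show "continuous_on UNIV g'"
      using g'' by (meson continuous_at_imp_continuous_on has_derivative_continuous)
    show "range (\<lambda>h. \<eta>' (g yb) (g' yb h)) = E"
      using nondegenerate_range_reduction[OF \<Theta>(2) gyb A2 g'(1) \<eta>'(1)[OF V(1)] openV V(1,4,5)]
        range\<eta>' by simp
  qed (use g' g'' \<Theta> openV V \<eta>' range\<eta>' \<Xi> in auto)
  obtain W f' where W: "(xb, yb) \<in> W" "open W"
    "\<And>p. p \<in> W \<Longrightarrow> (f has_derivative blinfun_apply (f' p)) (at p)" "continuous_on W f'"
    using f_smooth unfolding C1_on_def by auto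
  let ?f' = "f' (xb, yb)"
  have f: "(f has_derivative blinfun_apply ?f') (at (xb, yb))" by (rule W(3)[OF W(1)])
  have adj_jac: "transpose (jacobian g (at y)) *v w = adj (g' y) w" for y w
    by (rule transpose_jacobian_mult[OF g'(1)])
  have eq0: "f (xb, yb) + adj (g' yb) lamb = 0"
    using multiplier(2) unfolding lagrangian_def adj_jac .
  have "((\<lambda>x. f (x, yb)) has_derivative (\<lambda>u. ?f' (u, 0))) (at xb)"
    using diff_chain_at[OF has_derivative_Pair[OF has_derivative_ident has_derivative_const] f]
    by (simp add: o_def)
  then have J1: "jacobian (\<lambda>x. f (x, yb)) (at xb) *v u = ?f' (u, 0)" for u
    by (rule jacobian_mult)
  have d1: "((\<lambda>y. f (xb, y)) has_derivative (\<lambda>v. ?f' (0, v))) (at yb)"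
    using diff_chain_at[OF has_derivative_Pair[OF has_derivative_const has_derivative_ident] f]
    by (simp add: o_def)
  have d2: "((\<lambda>y. adj (g' y) lamb) has_derivative (\<lambda>v. adj (g'' yb v) lamb)) (at yb)"
    by (rule bounded_linear.has_derivative[OF adj.bounded_linear_left g''])
  have J2: "jacobian (\<lambda>y. lagrangian f g xb y lamb) (at yb) *v v
      = ?f' (0, v) + adj (g'' yb v) lamb" for v
    unfolding lagrangian_def adj_jac by (rule jacobian_mult[OF has_derivative_add[OF d1 d2]])
  have f'_split: "?f' (u, v) = ?f' (u, 0) + ?f' (0, v)" for u v
    by (simp flip: blinfun.add_right)
  let ?N = "\<lambda>v. normal_cone (critical_cone \<Theta> (g yb) lamb) (jacobian g (at yb) *v v)"
  let ?R = "\<lambda>u. {v. 0 \<in> (\<lambda>w. jacobian (\<lambda>x. f (x, yb)) (at xb) *v u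
                        + jacobian (\<lambda>y. lagrangian f g xb y lamb) (at yb) *v v
                        + transpose (jacobian g (at yb)) *v w) ` ?N v}"
  have R: "v \<in> ?R u \<longleftrightarrow> (\<exists>w \<in> normal_cone (critical_cone \<Theta> (g yb) lamb) (g' yb v).
      ?f' (u, v) + adj (g'' yb v) lamb + adj (g' yb) w = 0)" for u v
    unfolding J1 J2 adj_jac jacobian_mult[OF g'(1)] f'_split[of u v]
    by (auto simp: image_iff add.assoc eq_commute[of 0])
  have sub: "graphical_derivative S (xb, yb) u \<subseteq> ?R u" for u
  proof
    fix v assume "v \<in> graphical_derivative S (xb, yb) u"
    then have "(u, v) \<in> tangent_cone (gph (solution_map f (g -` \<Theta>))) (xb, yb)"
      by (simp add: graphical_derivative_def S_def Gamma_def)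
    then show "v \<in> ?R u"
      unfolding R by (rule tangent_graph_imp_equation[OF f eq0 multiplier(1) PDC])
  qed
  have sup: "?R u \<subseteq> graphical_derivative S (xb, yb) u"
    if "surj (\<lambda>u. jacobian (\<lambda>x. f (x, yb)) (at xb) *v u)" for u
  proof
    fix v assume "v \<in> ?R u"
    then obtain w where w: "w \<in> normal_cone (critical_cone \<Theta> (g yb) lamb) (g' yb v)"
      "?f' (u, v) + adj (g'' yb v) lamb + adj (g' yb) w = 0"
      unfolding R by blast
    have "(u, v) \<in> tangent_cone (gph (solution_map f (g -` \<Theta>))) (xb, yb)"
    proof (rule equation_imp_tangent_graph[OF f _ _ eq0 multiplier(1) PDC w])
      show "strict_derivative f ?f' (xb, yb)"
        by (rule C1_strict_derivative[OF W(2,1,3,4)])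
      show "surj (\<lambda>u. ?f' (u, 0))" using that by (simp add: J1)
    qed
    then show "v \<in> graphical_derivative S (xb, yb) u"
      by (simp add: graphical_derivative_def S_def Gamma_def)
  qed
  show ?thesis
    by (intro conjI allI impI sub equalityI[OF sub sup])
qed

end
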